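(* Let $\mathcal V$ be an algebra of differentiable functions and $A=\bigoplus_{i\in I}\mathbb F[\partial]u_i$ with zero $\lambda$-bracket acting on $\mathcal V$ by ${u_i}_\lambda f=\sum_n\lambda^n\frac{\partial f}{\partial u_i^{(n)}}$. Define $\Phi^\bullet:\tilde\Gamma^\bullet(A,\mathcal V)\to\tilde\Omega^\bullet(\mathcal V)$ by $\Phi^0=\mathrm{id}_{\mathcal V}$ and, for $k\ge1$, $\Phi^k(\tilde\gamma)=\frac1{k!}\sum_{i_r\in I,m_r\in\mathbb Z_+}f^{m_1\cdots m_k}_{i_1\cdots i_k}\,\delta u_{i_1}^{(m_1)}\wedge\cdots\wedge\delta u_{i_k}^{(m_k)}$, where $f^{m_1\cdots m_k}_{i_1\cdots i_k}$ is the coefficient of $\lambda_1^{m_1}\cdots\lambda_k^{m_k}$ in $\tilde\gamma_{\lambda_1,\dots,\lambda_k}(u_{i_1},\dots,u_{i_k})$. Then $\Phi^\bullet$ is a bijective superalgebra isomorphism (for the exterior products) satisfying $\Phi\circ\delta=\delta\circ\Phi$ and $\Phi\circ\iota_\xi=\iota_{\Phi_1(\xi)}\circ\Phi$ for all $\xi\in\tilde\Gamma_1$; hence it is an isomorphism of $\mathfrak g$-complexes (identifying $\Pi\tilde\Gamma_1$ with $\mathfrak g$ via $\Phi_1$). Moreover $\Phi^\bullet\circ\partial=\partial\circ\Phi^\bullet$, so it induces an isomorphism of reduced $\mathfrak g^\partial$-complexes $\Gamma^\bullet(A,\mathcal V)\simeq\Omega^\bullet(\mathcal V)$.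
   Context: $\mathbb F$ field of characteristic 0, $I=\{1,\dots,\ell\}$ finite. Algebra of differentiable functions $\mathcal V$: unital commutative associative with derivation $\partial$ and commuting derivations $\frac{\partial}{\partial u_i^{(n)}}$, finitely many nonzero on each element, $[\frac{\partial}{\partial u_i^{(n)}},\partial]=\frac{\partial}{\partial u_i^{(n-1)}}$. $\mathfrak g$ = vector fields $\sum P_{i,n}\frac{\partial}{\partial u_i^{(n)}}$, $\mathfrak g^\partial$ those commuting with $\partial$. $\tilde\Gamma^k(A,\mathcal V)$: $\mathbb F$-linear $\tilde\gamma:A^{\otimes k}\to\mathbb F[\lambda_1..\lambda_k]\otimes\mathcal V$ with $\tilde\gamma(..,\partial a_i,..)=-\lambda_i\tilde\gamma$ and skew-symmetric under simultaneous permutation of $a_i,\lambda_i$; here $(\delta\tilde\gamma)_{\lambda_1..\lambda_{k+1}}(a_1..a_{k+1})=\sum_i(-1)^{i+1}{a_i}_{\lambda_i}\tilde\gamma_{\lambda_1\overset{i}{\check\cdots}\lambda_{k+1}}(a_1\overset{i}{\check\cdots}a_{k+1})$; $(\partial\tilde\gamma)_{\lambda_1..\lambda_k}=(\partial+\lambda_1+\dots+\lambda_k)\tilde\gamma_{\lambda_1..\lambda_k}$; wedge product $(\tilde\alpha\wedge\tilde\beta)=\sum_{\sigma\in S_{h+k}}\frac{\mathrm{sign}\sigma}{h!k!}\tilde\alpha_{\lambda_{\sigma(1)}..}(a_{\sigma(1)}..)\tilde\beta_{..\lambda_{\sigma(h+k)}}(..a_{\sigma(h+k)})$; $\Gamma^\bullet=\tilde\Gamma^\bullet/\partial\tilde\Gamma^\bullet$.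 $\tilde\Gamma_1=(A\otimes\mathcal V[[x]])/(\partial\otimes1+1\otimes\partial_x)(\cdots)$, each element uniquely $\xi=\sum_iu_i\otimes P_i(x)$, $P_i(x)=\sum_n\frac1{n!}P_{i,n}x^n$; contraction $(\iota_\xi\tilde\gamma)_{\lambda_2..\lambda_k}(a_2..a_k)=\sum_i\langle P_i(x_1),\tilde\gamma_{\lambda_1,..,\lambda_k}(u_i,a_2,..,a_k)\rangle$ with $\langle x^m,\lambda^n\rangle=n!\delta_{mn}$ followed by multiplication in $\mathcal V$; $\Phi_1(\xi)=\sum_{i,n}P_{i,n}\frac{\partial}{\partial u_i^{(n)}}$, a Lie algebra isomorphism $\Pi\tilde\Gamma_1\to\mathfrak g$ for the bracket $[u_i\otimes P(x),u_j\otimes Q(x)]=-u_i\otimes\sum_nQ_n\frac{\partial P(x)}{\partial u_j^{(n)}}+u_j\otimes\sum_mP_m\frac{\partial Q(x)}{\partial u_i^{(m)}}$. A $\mathfrak g$-complex structure means the $\mathbb Z$-graded Lie superalgebra homomorphism from $\eta\mathfrak g\oplus\mathfrak g\oplus\mathbb F\partial_\eta$ given by $\partial_\eta\mapsto\delta$, $\eta X\mapsto\iota_X$, $X\mapsto L_X=\delta\iota_X+\iota_X\delta$. $\tilde\Omega^\bullet$: free supercommutative $\mathcal V$-algebra on odd degree-1 generators $\delta u_i^{(n)}$; $\delta$ odd derivation with $\delta f=\sum\frac{\partial f}{\partial u_i^{(n)}}\delta u_i^{(n)}$, $\delta(\delta u_i^{(n)})=0$; for $X=\sum P_{i,n}\frac{\partial}{\partial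 u_i^{(n)}}$, $\iota_X$ odd derivation of degree $-1$ with $\iota_X(f)=0$, $\iota_X(\delta u_i^{(n)})=P_{i,n}$; $\partial$ even derivation extending $\partial$ with $\partial(\delta u_i^{(n)})=\delta u_i^{(n+1)}$; $\Omega^\bullet=\tilde\Omega^\bullet/\partial\tilde\Omega^\bullet$. *)

theory Defs
  imports "HOL-Library.Poly_Mapping" "HOL-Library.Groups_Big_Fun" "HOL-Library.Product_Lexorder"
    "HOL-Computational_Algebra.Polynomial" "HOL-Combinatorics.Permutations"
begin

text \<open>The base field F is a type 'f of class field_char_0; the algebra V is a type 'v of class
  comm_ring_1 together with the structure map emb : F \<rightarrow> V (a unital ring homomorphism, making V a
  unital commutative associative F-algebra).  The index set I is a finite linearly ordered type 'i.
  d is the derivation \<partial>, and pd i n is the partial derivative with respect to u_i^(n).\<close>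

definition is_ring_hom_emb :: "('f::field_char_0 \<Rightarrow> 'v::comm_ring_1) \<Rightarrow> bool" where
  "is_ring_hom_emb emb \<longleftrightarrow> emb 1 = 1 \<and> (\<forall>a b. emb (a + b) = emb a + emb b) \<and>
     (\<forall>a b. emb (a * b) = emb a * emb b)"

definition is_derivation :: "('f::field_char_0 \<Rightarrow> 'v::comm_ring_1) \<Rightarrow> ('v \<Rightarrow> 'v) \<Rightarrow> bool" where
  "is_derivation emb D \<longleftrightarrow> (\<forall>a b. D (a + b) = D a + D b) \<and> (\<forall>c a. D (emb c * a) = emb c * D a) \<and>
     (\<forall>a b. D (a * b) = D a * b + a * D b)"

definition alg_diff_fun ::
  "('f::field_char_0 \<Rightarrow> 'v::comm_ring_1) \<Rightarrow> ('v \<Rightarrow> 'v) \<Rightarrow> ('i \<Rightarrow> nat \<Rightarrow> 'v \<Rightarrow> 'v) \<Rightarrow> bool" where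
  "alg_diff_fun emb d pd \<longleftrightarrow>
     is_ring_hom_emb emb \<and> is_derivation emb d \<and> (\<forall>i n. is_derivation emb (pd i n)) \<and>
     (\<forall>i n j m f. pd i n (pd j m f) = pd j m (pd i n f)) \<and>
     (\<forall>f. finite {(i, n). pd i n f \<noteq> 0}) \<and>
     (\<forall>i f. pd i 0 (d f) = d (pd i 0 f)) \<and>
     (\<forall>i n f. pd i (Suc n) (d f) = d (pd i (Suc n) f) + pd i n f)"

text \<open>Polynomials in the variables \<lambda>_0, \<lambda>_1, ... (0-indexed: \<lambda>_j of the paper is variable j-1)
  with coefficients in V: finitely supported maps from monomials (nat =>0 nat) to V.\<close>

type_synonym 'v lpoly = "(nat \<Rightarrow>\<^sub>0 nat) \<Rightarrow>\<^sub>0 'v"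

definition lvar :: "nat \<Rightarrow> 'v::comm_ring_1 lpoly" where
  "lvar j = Poly_Mapping.single (Poly_Mapping.single j 1) 1"

definition lconst :: "'v::comm_ring_1 \<Rightarrow> 'v lpoly" where
  "lconst v = Poly_Mapping.single 0 v"

definition mon_of_list :: "nat list \<Rightarrow> (nat \<Rightarrow>\<^sub>0 nat)" where
  "mon_of_list ms = (\<Sum>j<length ms. Poly_Mapping.single j (ms ! j))"

definition ren_mon :: "(nat \<Rightarrow> nat) \<Rightarrow> (nat \<Rightarrow>\<^sub>0 nat) \<Rightarrow> (nat \<Rightarrow>\<^sub>0 nat)" where
  "ren_mon \<rho> \<mu> = (\<Sum>j\<in>Poly_Mapping.keys \<mu>. Poly_Mapping.single (\<rho> j) (Poly_Mapping.lookup \<mu> j))"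

definition ren :: "(nat \<Rightarrow> nat) \<Rightarrow> 'v::comm_ring_1 lpoly \<Rightarrow> 'v lpoly" where
  "ren \<rho> Q = (\<Sum>\<mu>\<in>Poly_Mapping.keys Q. Poly_Mapping.single (ren_mon \<rho> \<mu>) (Poly_Mapping.lookup Q \<mu>))"

text \<open>Drop the variable \<lambda>_0 (whose exponent has been used up) and shift \<lambda>_{j+1} \<mapsto> \<lambda>_j.\<close>
definition mon_tl :: "(nat \<Rightarrow>\<^sub>0 nat) \<Rightarrow> (nat \<Rightarrow>\<^sub>0 nat)" where
  "mon_tl \<mu> = (\<Sum>j\<in>Poly_Mapping.keys \<mu> - {0}. Poly_Mapping.single (j - 1) (Poly_Mapping.lookup \<mu> j))"

definition coeffwise :: "('v \<Rightarrow> 'v) \<Rightarrow> 'v::comm_ring_1 lpoly \<Rightarrow> 'v lpoly" where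
  "coeffwise D Q = (\<Sum>\<mu>\<in>Poly_Mapping.keys Q. Poly_Mapping.single \<mu> (D (Poly_Mapping.lookup Q \<mu>)))"

definition vars_below :: "nat \<Rightarrow> 'v::comm_ring_1 lpoly \<Rightarrow> bool" where
  "vars_below k Q \<longleftrightarrow> (\<forall>\<mu>\<in>Poly_Mapping.keys Q. Poly_Mapping.keys \<mu> \<subseteq> {..<k})"

text \<open>An element a = \<Sum>_i p_i(\<partial>) u_i of A is represented by the family of polynomials p_i.\<close>
type_synonym ('i, 'f) amod = "'i \<Rightarrow> 'f poly"

definition gen_u :: "'i \<Rightarrow> ('i, 'f::field_char_0) amod" where
  "gen_u i = (\<lambda>c. if c = i then 1 else 0)"

definition dA :: "('i, 'f::field_char_0) amod \<Rightarrow> ('i, 'f) amod" where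
  "dA a = (\<lambda>c. [:0, 1:] * a c)"

definition smultA :: "'f::field_char_0 \<Rightarrow> ('i, 'f) amod \<Rightarrow> ('i, 'f) amod" where
  "smultA s a = (\<lambda>c. smult s (a c))"

definition poly_neg_var :: "('f::field_char_0 \<Rightarrow> 'v::comm_ring_1) \<Rightarrow> 'f poly \<Rightarrow> nat \<Rightarrow> 'v lpoly" where
  "poly_neg_var emb p j =
     (\<Sum>e\<le>Polynomial.degree p. Poly_Mapping.single (Poly_Mapping.single j e)
        (emb ((-1) ^ e * Polynomial.coeff p e)))"

definition act_gen :: "('i \<Rightarrow> nat \<Rightarrow> 'v \<Rightarrow> 'v) \<Rightarrow> 'i \<Rightarrow> nat \<Rightarrow> 'v::comm_ring_1 \<Rightarrow> 'v lpoly" where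
  "act_gen pd i j f = Sum_any (\<lambda>n. Poly_Mapping.single (Poly_Mapping.single j n) (pd i n f))"

text \<open>a_{\<lambda>_j} acting on F[\<lambda>'s]\<otimes>V (coefficientwise), extended from the generators by
  sesquilinearity: (p(\<partial>) u_i)_\<lambda> f = p(-\<lambda>) {u_i}_\<lambda> f.\<close>
definition act :: "('f::field_char_0 \<Rightarrow> 'v::comm_ring_1) \<Rightarrow> ('i::finite \<Rightarrow> nat \<Rightarrow> 'v \<Rightarrow> 'v) \<Rightarrow>
    ('i, 'f) amod \<Rightarrow> nat \<Rightarrow> 'v lpoly \<Rightarrow> 'v lpoly" where
  "act emb pd a j Q =
     (\<Sum>\<mu>\<in>Poly_Mapping.keys Q. \<Sum>c\<in>UNIV. poly_neg_var emb (a c) j * act_gen pd c j (Poly_Mapping.lookup Q \<mu>) *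
         Poly_Mapping.single \<mu> 1)"

text \<open>A k-cochain \<gamma> is a map on lists of elements of A; on lists of length k it is an F-multilinear
  map A^k \<rightarrow> F[\<lambda>_1..\<lambda>_k]\<otimes>V (i.e. a linear map on A^{\<otimes>k}), sesquilinear and skew-symmetric;
  on lists of other lengths it is 0.\<close>
type_synonym ('i, 'f, 'v) cochain = "('i, 'f) amod list \<Rightarrow> 'v lpoly"

definition Gamma_t :: "('f::field_char_0 \<Rightarrow> 'v::comm_ring_1) \<Rightarrow> nat \<Rightarrow> ('i, 'f, 'v) cochain set" where
  "Gamma_t emb k = {\<gamma>.
     (\<forall>as. length as \<noteq> k \<longrightarrow> \<gamma> as = 0) \<and>
     (\<forall>as. length as = k \<longrightarrow> vars_below k (\<gamma> as)) \<and>
     (\<forall>as j b c. length as = k \<longrightarrow> j < k \<longrightarrow>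
         \<gamma> (as[j := (\<lambda>i. b i + c i)]) = \<gamma> (as[j := b]) + \<gamma> (as[j := c])) \<and>
     (\<forall>as j s b. length as = k \<longrightarrow> j < k \<longrightarrow>
         \<gamma> (as[j := smultA s b]) = lconst (emb s) * \<gamma> (as[j := b])) \<and>
     (\<forall>as j. length as = k \<longrightarrow> j < k \<longrightarrow>
         \<gamma> (as[j := dA (as ! j)]) = - (lvar j * \<gamma> as)) \<and>
     (\<forall>as \<sigma>. length as = k \<longrightarrow> \<sigma> permutes {..<k} \<longrightarrow>
         ren \<sigma> (\<gamma> (map (\<lambda>j. as ! \<sigma> j) [0..<k])) = lconst (of_int (sign \<sigma>)) * \<gamma> as)}"

definition deltaG :: "('f::field_char_0 \<Rightarrow> 'v::comm_ring_1) \<Rightarrow> ('i::finite \<Rightarrow> nat \<Rightarrow> 'v \<Rightarrow> 'v) \<Rightarrow>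
    nat \<Rightarrow> ('i, 'f, 'v) cochain \<Rightarrow> ('i, 'f, 'v) cochain" where
  "deltaG emb pd k \<gamma> as =
     (if length as = Suc k then
        (\<Sum>i\<le>k. (-1) ^ i * act emb pd (as ! i) i
            (ren (\<lambda>j. if j < i then j else Suc j) (\<gamma> (take i as @ drop (Suc i) as))))
      else 0)"

definition dG :: "('v::comm_ring_1 \<Rightarrow> 'v) \<Rightarrow> nat \<Rightarrow> ('i, 'f::field_char_0, 'v) cochain \<Rightarrow> ('i, 'f, 'v) cochain" where
  "dG d k \<gamma> as = coeffwise d (\<gamma> as) + (\<Sum>j<k. lvar j) * \<gamma> as"

definition wedgeG :: "('f::field_char_0 \<Rightarrow> 'v::comm_ring_1) \<Rightarrow> nat \<Rightarrow> nat \<Rightarrow>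
    ('i, 'f, 'v) cochain \<Rightarrow> ('i, 'f, 'v) cochain \<Rightarrow> ('i, 'f, 'v) cochain" where
  "wedgeG emb h k \<alpha> \<beta> as =
     (if length as = h + k then
        (\<Sum>\<sigma>\<in>{\<sigma>. \<sigma> permutes {..<h + k}}.
           lconst (of_int (sign \<sigma>) * emb (1 / (fact h * fact k))) *
           ren (\<lambda>j. \<sigma> j) (\<alpha> (map (\<lambda>j. as ! \<sigma> j) [0..<h])) *
           ren (\<lambda>j. \<sigma> (h + j)) (\<beta> (map (\<lambda>j. as ! \<sigma> (h + j)) [0..<k])))
      else 0)"

text \<open>An element \<xi> = \<Sum>_i u_i \<otimes> P_i(x) of \<Gamma>~_1, P_i(x) = \<Sum>_n P_{i,n} x^n / n!, is represented by the
  family P :: 'i \<Rightarrow> nat \<Rightarrow> V (this representation is unique).  Its image \<Phi>_1(\<xi>) is the vector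
  field \<Sum> P_{i,n} \<partial>/\<partial>u_i^(n), likewise represented by the family P.
  Contraction: (\<iota>_\<xi>\<gamma>)(a_2..a_k) = \<Sum>_i <P_i(x_1), \<gamma>_{\<lambda>_1..\<lambda>_k}(u_i,a_2,..,a_k)>, <x^m,\<lambda>^n> = n! \<delta>_{mn}.\<close>
definition iotaG :: "('f::field_char_0 \<Rightarrow> 'v::comm_ring_1) \<Rightarrow> ('i::finite \<Rightarrow> nat \<Rightarrow> 'v) \<Rightarrow>
    ('i, 'f, 'v) cochain \<Rightarrow> ('i, 'f, 'v) cochain" where
  "iotaG emb P \<gamma> as =
     (\<Sum>c\<in>UNIV. \<Sum>\<mu>\<in>Poly_Mapping.keys (\<gamma> (gen_u c # as)).
        Poly_Mapping.single (mon_tl \<mu>)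
          (emb (1 / fact (Poly_Mapping.lookup \<mu> 0)) * P c (Poly_Mapping.lookup \<mu> 0) * emb (fact (Poly_Mapping.lookup \<mu> 0)) *
           Poly_Mapping.lookup (\<gamma> (gen_u c # as)) \<mu>))"

text \<open>The free supercommutative V-algebra on the odd generators \<delta>u_i^(n), realised through its
  standard V-basis: to a finite set S of generators (i,n) corresponds the product of the \<delta>u's in S
  taken in increasing order.  A form is a finitely supported map from sets of generators to V.\<close>
type_synonym ('i, 'v) form = "('i \<times> nat) set \<Rightarrow>\<^sub>0 'v"

definition Omega_t :: "nat \<Rightarrow> ('i::linorder, 'v::comm_ring_1) form set" where
  "Omega_t k = {\<omega>. \<forall>S\<in>Poly_Mapping.keys \<omega>. finite S \<and> card S = k}"

definition wedgeO :: "('i::linorder, 'v::comm_ring_1) form \<Rightarrow> ('i, 'v) form \<Rightarrow> ('i, 'v) form" where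
  "wedgeO \<omega> \<eta> =
     (\<Sum>S\<in>Poly_Mapping.keys \<omega>. \<Sum>T\<in>Poly_Mapping.keys \<eta>.
        if S \<inter> T = {} then
          Poly_Mapping.single (S \<union> T)
            ((-1) ^ card {(s, t). s \<in> S \<and> t \<in> T \<and> t < s} * Poly_Mapping.lookup \<omega> S * Poly_Mapping.lookup \<eta> T)
        else 0)"

definition oneO :: "('i::linorder, 'v::comm_ring_1) form" where
  "oneO = Poly_Mapping.single {} 1"

definition scO :: "'v \<Rightarrow> ('i::linorder, 'v::comm_ring_1) form \<Rightarrow> ('i, 'v) form" where
  "scO f \<omega> = (\<Sum>S\<in>Poly_Mapping.keys \<omega>. Poly_Mapping.single S (f * Poly_Mapping.lookup \<omega> S))"

definition genO :: "'i \<times> nat \<Rightarrow> ('i::linorder, 'v::comm_ring_1) form" where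
  "genO g = Poly_Mapping.single {g} 1"

definition wedge_list :: "('i \<times> nat) list \<Rightarrow> ('i::linorder, 'v::comm_ring_1) form" where
  "wedge_list gs = foldr (\<lambda>g \<omega>. wedgeO (genO g) \<omega>) gs oneO"

text \<open>\<delta>(f \<omega>_S) = \<delta>f \<and> \<omega>_S, with \<delta>f = \<Sum> \<partial>f/\<partial>u_i^(n) \<delta>u_i^(n) and \<delta>(\<delta>u_i^(n)) = 0.\<close>
definition deltaO :: "('i \<Rightarrow> nat \<Rightarrow> 'v \<Rightarrow> 'v) \<Rightarrow> ('i::linorder, 'v::comm_ring_1) form \<Rightarrow> ('i, 'v) form" where
  "deltaO pd \<omega> =
     (\<Sum>S\<in>Poly_Mapping.keys \<omega>. wedgeO
        (Sum_any (\<lambda>g. Poly_Mapping.single {g} (pd (fst g) (snd g) (Poly_Mapping.lookup \<omega> S))))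
        (Poly_Mapping.single S 1))"

text \<open>\<iota>_X for X = \<Sum> P_{i,n} \<partial>/\<partial>u_i^(n): the odd derivation of degree -1 with \<iota>_X f = 0 and
  \<iota>_X(\<delta>u_i^(n)) = P_{i,n}.\<close>
definition iotaO :: "('i \<Rightarrow> nat \<Rightarrow> 'v) \<Rightarrow> ('i::linorder, 'v::comm_ring_1) form \<Rightarrow> ('i, 'v) form" where
  "iotaO P \<omega> =
     (\<Sum>S\<in>Poly_Mapping.keys \<omega>. \<Sum>s\<in>S.
        Poly_Mapping.single (S - {s})
          ((-1) ^ card {t \<in> S. t < s} * P (fst s) (snd s) * Poly_Mapping.lookup \<omega> S))"

text \<open>\<partial>: the even derivation extending \<partial> on V with \<partial>(\<delta>u_i^(n)) = \<delta>u_i^(n+1).\<close>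
definition dO :: "('v \<Rightarrow> 'v) \<Rightarrow> ('i::linorder, 'v::comm_ring_1) form \<Rightarrow> ('i, 'v) form" where
  "dO d \<omega> =
     (\<Sum>S\<in>Poly_Mapping.keys \<omega>.
        Poly_Mapping.single S (d (Poly_Mapping.lookup \<omega> S)) +
        scO (Poly_Mapping.lookup \<omega> S)
          (\<Sum>j<card S. wedge_list ((sorted_list_of_set S)
               [j := (fst (sorted_list_of_set S ! j), Suc (snd (sorted_list_of_set S ! j)))])))"

definition Phi :: "('f::field_char_0 \<Rightarrow> 'v::comm_ring_1) \<Rightarrow> nat \<Rightarrow> ('i::{finite, linorder}, 'f, 'v) cochain \<Rightarrow>
    ('i, 'v) form" where
  "Phi emb k \<gamma> =
     (if k = 0 then Poly_Mapping.single {} (Poly_Mapping.lookup (\<gamma> []) 0)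
      else scO (emb (1 / fact k))
        (Sum_any (\<lambda>gs. if length gs = k then
            scO (Poly_Mapping.lookup (\<gamma> (map (\<lambda>g. gen_u (fst g)) gs)) (mon_of_list (map snd gs)))
                (wedge_list gs)
          else 0)))"

end

theory Submission
  imports Defs "HOL-Combinatorics.Multiset_Permutations"
begin

text \<open>A cochain \<open>\<gamma>\<close> is determined by its coefficients \<open>cochain_coeff \<gamma> [(i\<^sub>1, m\<^sub>1), \<dots>, (i\<^sub>k, m\<^sub>k)]\<close>,
  and skew-symmetry of \<open>\<gamma>\<close> says exactly that \<open>cochain_coeff \<gamma>\<close> is an alternating function of the list of
  generators.  Since \<open>\<delta>u\<^sub>1 \<and> \<dots> \<and> \<delta>u\<^sub>k\<close> is alternating as well, the \<open>k!\<close> orderings of a set \<open>S\<close>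
  of generators contribute equally to \<open>\<Phi> \<gamma>\<close>, so the component of \<open>\<Phi> \<gamma>\<close> at \<open>S\<close> is the value
  of \<open>cochain_coeff \<gamma>\<close> on \<open>S\<close> listed in increasing order.  This gives bijectivity: an alternating family of
  coefficients extends uniquely to a cochain by sesquilinearity.  The compatibilities with \<open>\<delta>\<close>,
  \<open>\<iota>\<close>, \<open>\<partial>\<close> and the products are then identities between coefficients.\<close>

text \<open>Basis forms are indexed by sets listed in increasing order, while cochains take ordered
  arguments. Every sign is therefore reduced to one function on lists, \<open>list_sign\<close>,
  whose recursion copies the rule for multiplying a generator onto a basis form. Division is
  available in V only through \<open>emb\<close>: it supplies 1/k!, and also the 1/2 that makes an
  alternating function vanish on lists with a repetition.

  Contraction and differential change a set of generators by one element, so they are compared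
  component by component. The product and \<partial> are instead compared as sums over all ordered
  lists: there a list of length h + k is just a pair of lists, which replaces a count of shuffles,
  and multiplication by \<lambda>_j is a shift of the j-th order. To keep such sums finite, finite
  sets of generators containing all relevant supports are chosen.\<close>

abbreviation (input) "lookup \<equiv> Poly_Mapping.lookup"
abbreviation (input) "keys \<equiv> Poly_Mapping.keys"
abbreviation (input) "single \<equiv> Poly_Mapping.single"

section \<open>Finitely supported maps and additive functions\<close>

lemma poly_mapping_sum_single: "(\<Sum>k\<in>keys p. single k (lookup p k)) = p"
  by (rule poly_mapping_eqI) (auto simp: lookup_sum lookup_single when_def sum.delta in_keys_iff)

text \<open>Every finitely supported map is a finite sum of one-point maps, and 0 is a one-point map
  with value 0. Applied twice, the rule reduces bilinear identities to monomials or basis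
  forms.\<close>

lemma poly_mapping_additive_induct [case_names single add]:
  fixes P :: "('a \<Rightarrow>\<^sub>0 'b::comm_monoid_add) \<Rightarrow> bool"
  assumes "\<And>k v. P (single k v)" and "\<And>p q. P p \<Longrightarrow> P q \<Longrightarrow> P (p + q)"
  shows "P p"
proof -
  have zero: "P 0" using assms(1)[of undefined 0] by simp
  have "P (\<Sum>k\<in>K. single k (lookup p k))" if "finite K" for K
    using that by (induction K rule: finite_induct) (auto intro: assms zero)
  from this[of "keys p"] show ?thesis by (simp add: poly_mapping_sum_single)
qed

text \<open>Operations defined by a sum over \<open>keys p\<close> are not visibly additive, since
  supports shrink when values cancel. A summand that vanishes at 0 lets the index set be enlarged;
  the same condition gives additivity below.\<close>

lemma sum_keys_superset:
  assumes "\<And>k. F k 0 = 0" and "finite K" and "keys p \<subseteq> K"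
  shows "(\<Sum>k\<in>keys p. F k (lookup p k)) = (\<Sum>k\<in>K. F k (lookup p k))"
  by (rule sum.mono_neutral_left) (use assms in \<open>auto simp: in_keys_iff\<close>)

lemma sum_keys_single:
  assumes "\<And>k. F k 0 = 0"
  shows "(\<Sum>k\<in>keys (single a v). F k (lookup (single a v) k)) = F a v"
  using assms by (subst sum_keys_superset[of F "{a}"]) auto

lemma sum_keys_add:
  assumes "\<And>k. F k 0 = 0" and "\<And>k a b. F k (a + b) = F k a + F k b"
  shows "(\<Sum>k\<in>keys (p + q). F k (lookup (p + q) k)) =
    (\<Sum>k\<in>keys p. F k (lookup p k)) + (\<Sum>k\<in>keys q. F k (lookup q k))"
  by (rule setsum_keys_plus_distrib) (use assms in auto)

lemma additive_sum:
  fixes F :: "'a::comm_monoid_add \<Rightarrow> 'b::cancel_comm_monoid_add"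
  assumes "\<And>a b. F (a + b) = F a + F b"
  shows "F (\<Sum>x\<in>A. f x) = (\<Sum>x\<in>A. F (f x))"
proof -
  have "F 0 = 0" using assms[of 0 0] by (metis add_cancel_right_right add_0)
  then show ?thesis by (induction A rule: infinite_finite_induct) (auto simp: assms)
qed

lemma additive_zero:
  fixes F :: "'a::comm_monoid_add \<Rightarrow> 'b::cancel_comm_monoid_add"
  assumes "\<And>a b. F (a + b) = F a + F b"
  shows "F 0 = 0"
  using additive_sum[of F "\<lambda>_. 0" "{}"] assms by simp

subsection \<open>Monomials and renaming of variables\<close>

lemma lookup_mon_of_list: "lookup (mon_of_list ms) j = (if j < length ms then ms ! j else 0)"
  by (auto simp: mon_of_list_def lookup_sum lookup_single when_def)

lemma keys_mon_of_list: "keys (mon_of_list ms) \<subseteq> {..<length ms}"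
  by (auto simp: in_keys_iff lookup_mon_of_list split: if_splits)

lemma mon_of_list_eq_iff: "length ms = length ns \<Longrightarrow> mon_of_list ms = mon_of_list ns \<longleftrightarrow> ms = ns"
  by (auto simp: poly_mapping_eq_iff fun_eq_iff lookup_mon_of_list list_eq_iff_nth_eq)

lemma mon_of_list_lookup: "keys \<mu> \<subseteq> {..<k} \<Longrightarrow> mon_of_list (map (lookup \<mu>) [0..<k]) = \<mu>"
  by (rule poly_mapping_eqI) (auto simp: lookup_mon_of_list in_keys_iff subset_iff)

lemma lookup_ren_mon: "lookup (ren_mon \<rho> \<mu>) i = (\<Sum>j\<in>keys \<mu>. lookup \<mu> j when \<rho> j = i)"
  by (simp add: ren_mon_def lookup_sum lookup_single)

lemma lookup_ren_mon_inj:
  assumes "inj_on \<rho> A" "keys \<mu> \<subseteq> A" "j \<in> A"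
  shows "lookup (ren_mon \<rho> \<mu>) (\<rho> j) = lookup \<mu> j"
proof -
  have "lookup (ren_mon \<rho> \<mu>) (\<rho> j) = (\<Sum>i\<in>keys \<mu>. if i = j then lookup \<mu> j else 0)"
    unfolding lookup_ren_mon
    by (rule sum.cong) (use assms in \<open>auto simp: when_def dest: inj_onD\<close>)
  then show ?thesis by (auto simp: in_keys_iff)
qed

lemma keys_ren_mon: "keys (ren_mon \<rho> \<mu>) \<subseteq> \<rho> ` keys \<mu>"
proof
  fix i assume "i \<in> keys (ren_mon \<rho> \<mu>)"
  then have "(\<Sum>j\<in>keys \<mu>. lookup \<mu> j when \<rho> j = i) \<noteq> 0" by (simp add: in_keys_iff lookup_ren_mon)
  then obtain j where "j \<in> keys \<mu>" "(lookup \<mu> j when \<rho> j = i) \<noteq> 0" by (rule sum.not_neutral_contains_not_neutral)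
  then show "i \<in> \<rho> ` keys \<mu>" by (auto simp: when_def split: if_splits)
qed

lemma ren_mon_add: "ren_mon \<rho> (\<mu> + \<nu>) = ren_mon \<rho> \<mu> + ren_mon \<rho> \<nu>"
  unfolding ren_mon_def by (rule sum_keys_add) (auto simp: single_add)

lemma ren_mon_single: "ren_mon \<rho> (single j n) = single (\<rho> j) n"
  unfolding ren_mon_def by (rule sum_keys_single) auto

lemma ren_mon_zero [simp]: "ren_mon \<rho> 0 = 0"
  by (simp add: ren_mon_def)

lemma ren_single: "ren \<rho> (single \<mu> v) = single (ren_mon \<rho> \<mu>) v"
  unfolding ren_def by (rule sum_keys_single) auto

lemma ren_add: "ren \<rho> (P + Q) = ren \<rho> P + ren \<rho> Q"
  unfolding ren_def by (rule sum_keys_add) (auto simp: single_add)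

lemmas ren_sum = additive_sum[of "ren \<rho>" for \<rho>, OF ren_add]

lemma ren_mult: "ren \<rho> (P * Q) = ren \<rho> P * ren \<rho> Q"
proof (induction P rule: poly_mapping_additive_induct)
  case (single \<mu> v)
  show ?case
    by (induction Q rule: poly_mapping_additive_induct)
      (simp_all add: mult_single ren_single ren_mon_add distrib_left ren_add)
qed (simp add: distrib_right ren_add)

lemma ren_one: "ren \<rho> 1 = 1"
  by (metis ren_single ren_mon_zero single_one)

lemma ren_prod: "ren \<rho> (\<Prod>j\<in>A. f j) = (\<Prod>j\<in>A. ren \<rho> (f j))"
  by (induction A rule: infinite_finite_induct) (simp_all add: ren_one ren_mult)

lemma ren_lvar: "ren \<rho> (lvar j) = lvar (\<rho> j)"
  by (simp add: lvar_def ren_single ren_mon_single)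

text \<open>As \<open>\<rho>\<close> is injective on the variables that occur, no two monomials of
  \<open>Q\<close> are merged: the only possible source of \<open>\<nu>\<close> is found by pulling
  its exponents back along \<open>\<rho>\<close>.\<close>

lemma lookup_ren:
  assumes "inj_on \<rho> {..<k}" "vars_below k Q"
  shows "lookup (ren \<rho> Q) \<nu> = (if keys \<nu> \<subseteq> \<rho> ` {..<k}
    then lookup Q (mon_of_list (map (\<lambda>j. lookup \<nu> (\<rho> j)) [0..<k])) else 0)"
proof -
  let ?\<mu> = "mon_of_list (map (\<lambda>j. lookup \<nu> (\<rho> j)) [0..<k])"
  have eq: "ren_mon \<rho> \<mu> = \<nu> \<longleftrightarrow> keys \<nu> \<subseteq> \<rho> ` {..<k} \<and> \<mu> = ?\<mu>" if "\<mu> \<in> keys Q" for \<mu>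
  proof -
    have \<mu>: "keys \<mu> \<subseteq> {..<k}" using that assms(2) by (simp add: vars_below_def)
    note l = lookup_ren_mon_inj[OF assms(1) \<mu>]
    show ?thesis
    proof (intro iffI conjI)
      assume a: "ren_mon \<rho> \<mu> = \<nu>"
      show "keys \<nu> \<subseteq> \<rho> ` {..<k}" using keys_ren_mon[of \<rho> \<mu>] \<mu> a by blast
      show "\<mu> = ?\<mu>"
        by (rule poly_mapping_eqI) (use \<mu> l a in \<open>auto simp: lookup_mon_of_list in_keys_iff subset_iff\<close>)
    next
      assume a: "keys \<nu> \<subseteq> \<rho> ` {..<k} \<and> \<mu> = ?\<mu>"
      show "ren_mon \<rho> \<mu> = \<nu>"
      proof (rule poly_mapping_eqI)
        fix i
        show "lookup (ren_mon \<rho> \<mu>) i = lookup \<nu> i"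
        proof (cases "i \<in> \<rho> ` {..<k}")
          case True
          then show ?thesis using l a by (auto simp: lookup_mon_of_list)
        next
          case False
          then have "i \<notin> keys (ren_mon \<rho> \<mu>)" "i \<notin> keys \<nu>" using keys_ren_mon[of \<rho> \<mu>] \<mu> a by blast+
          then show ?thesis by (simp add: in_keys_iff)
        qed
      qed
    qed
  qed
  have "lookup (ren \<rho> Q) \<nu> = (\<Sum>\<mu>\<in>keys Q. if \<mu> = ?\<mu> then (lookup Q ?\<mu> when keys \<nu> \<subseteq> \<rho> ` {..<k}) else 0)"
    unfolding ren_def lookup_sum lookup_single
    by (rule sum.cong) (auto simp: when_def eq)
  then show ?thesis by (auto simp: in_keys_iff)
qed

lemma keys_ren:
  assumes "inj_on \<rho> {..<k}" "vars_below k Q" "\<nu> \<in> keys (ren \<rho> Q)"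
  shows "keys \<nu> \<subseteq> \<rho> ` {..<k}"
  using assms(3) unfolding in_keys_iff lookup_ren[OF assms(1,2)] by (simp only: split: if_splits) blast+

lemma lookup_lconst_mult: "lookup (lconst v * Q) \<mu> = v * lookup Q \<mu>"
  by (induction Q rule: poly_mapping_additive_induct)
    (auto simp: lconst_def mult_single lookup_single when_def distrib_left lookup_add)

lemma lookup_lvar_mult: "lookup (lvar j * Q) \<mu> = (if lookup \<mu> j > 0 then lookup Q (\<mu> - single j 1) else 0)"
proof (induction Q rule: poly_mapping_additive_induct)
  case (single \<nu> v)
  have "single j 1 + \<nu> = \<mu> \<longleftrightarrow> lookup \<mu> j > 0 \<and> \<nu> = \<mu> - single j 1"
  proof (intro iffI conjI)
    assume "lookup \<mu> j > 0 \<and> \<nu> = \<mu> - single j 1"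
    then show "single j 1 + \<nu> = \<mu>"
      by (intro poly_mapping_eqI) (auto simp: lookup_add lookup_minus lookup_single when_def)
  qed (auto simp: lookup_add)
  then show ?case by (auto simp: lvar_def mult_single lookup_single when_def)
qed (simp add: distrib_left lookup_add)

text \<open>With disjoint sets of variables a monomial splits in only one way, so the convolution
  sum collapses to one term. This separates \<lambda>_j from the other variables in the action, and
  the two blocks of variables in the exterior product.\<close>

lemma lookup_mult_disjoint:
  assumes "\<And>\<mu>. \<mu> \<in> keys P \<Longrightarrow> keys \<mu> \<subseteq> A" "\<And>\<mu>. \<mu> \<in> keys Q \<Longrightarrow> keys \<mu> \<subseteq> B" "A \<inter> B = {}"
    and "keys \<mu> \<subseteq> A" "keys \<nu> \<subseteq> B"
  shows "lookup (P * Q) (\<mu> + \<nu>) = lookup P \<mu> * (lookup Q \<nu> :: 'v::comm_ring_1)"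
proof -
  have eq: "\<mu>' + \<nu>' = \<mu> + \<nu> \<longleftrightarrow> \<mu>' = \<mu> \<and> \<nu>' = \<nu>" if "\<mu>' \<in> keys P" "\<nu>' \<in> keys Q" for \<mu>' \<nu>'
  proof
    assume e: "\<mu>' + \<nu>' = \<mu> + \<nu>"
    have le: "lookup \<mu>' i + lookup \<nu>' i = lookup \<mu> i + lookup \<nu> i" for i
      using arg_cong[OF e, of "\<lambda>x. lookup x i"] by (simp add: lookup_add)
    have z: "(i \<notin> A \<longrightarrow> lookup \<mu>' i = 0 \<and> lookup \<mu> i = 0) \<and> (i \<notin> B \<longrightarrow> lookup \<nu>' i = 0 \<and> lookup \<nu> i = 0)" for i
      using assms(1)[OF that(1)] assms(2)[OF that(2)] assms(4,5) by (auto simp: in_keys_iff subset_iff)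
    have "lookup \<mu>' i = lookup \<mu> i \<and> lookup \<nu>' i = lookup \<nu> i" for i
    proof (cases "i \<in> A")
      case True
      then have "i \<notin> B" using assms(3) by auto
      then show ?thesis using le[of i] z[of i] by simp
    next
      case False
      then show ?thesis using le[of i] z[of i] by simp
    qed
    then show "\<mu>' = \<mu> \<and> \<nu>' = \<nu>" by (auto intro: poly_mapping_eqI)
  qed auto
  have "P * Q = (\<Sum>\<mu>'\<in>keys P. single \<mu>' (lookup P \<mu>')) * (\<Sum>\<nu>'\<in>keys Q. single \<nu>' (lookup Q \<nu>'))"
    by (simp only: poly_mapping_sum_single)
  also have "\<dots> = (\<Sum>\<mu>'\<in>keys P. \<Sum>\<nu>'\<in>keys Q. single (\<mu>' + \<nu>') (lookup P \<mu>' * lookup Q \<nu>'))"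
    by (simp add: sum_product mult_single)
  finally have "lookup (P * Q) (\<mu> + \<nu>) =
     (\<Sum>\<mu>'\<in>keys P. \<Sum>\<nu>'\<in>keys Q. lookup P \<mu>' * lookup Q \<nu>' when \<mu>' + \<nu>' = \<mu> + \<nu>)"
    by (simp add: lookup_sum lookup_single)
  also have "\<dots> = (\<Sum>\<mu>'\<in>keys P. \<Sum>\<nu>'\<in>keys Q. if \<mu>' = \<mu> then (if \<nu>' = \<nu> then lookup P \<mu> * lookup Q \<nu> else 0) else 0)"
    by (intro sum.cong refl) (auto simp: when_def eq)
  also have "\<dots> = (\<Sum>\<mu>'\<in>keys P. if \<mu>' = \<mu> then lookup P \<mu> * lookup Q \<nu> else 0)"
    by (intro sum.cong refl) (auto simp: in_keys_iff)
  also have "\<dots> = lookup P \<mu> * lookup Q \<nu>" by (auto simp: in_keys_iff)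
  finally show ?thesis .
qed

section \<open>Polynomials in the first k variables\<close>

lemma vars_below_zero [simp]: "vars_below k 0"
  by (simp add: vars_below_def)

lemma vars_below_add: "vars_below k P \<Longrightarrow> vars_below k Q \<Longrightarrow> vars_below k (P + Q)"
  using keys_add[of P Q] by (auto simp: vars_below_def)

lemma vars_below_sum: "(\<And>x. x \<in> A \<Longrightarrow> vars_below k (f x)) \<Longrightarrow> vars_below k (\<Sum>x\<in>A. f x)"
  by (induction A rule: infinite_finite_induct) (auto intro: vars_below_add)

lemma vars_below_mult:
  assumes "vars_below k P" "vars_below k Q"
  shows "vars_below k (P * Q)"
  unfolding vars_below_def
proof
  fix \<mu> assume "\<mu> \<in> keys (P * Q)"
  then obtain a b where "a \<in> keys P" "b \<in> keys Q" "\<mu> = a + b" using keys_mult[of P Q] by blast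
  then show "keys \<mu> \<subseteq> {..<k}" using assms keys_add[of a b] unfolding vars_below_def by blast
qed

lemma vars_below_single: "keys \<mu> \<subseteq> {..<k} \<Longrightarrow> vars_below k (single \<mu> v)"
  by (auto simp: vars_below_def)

lemma vars_below_prod: "(\<And>x. x \<in> A \<Longrightarrow> vars_below k (f x)) \<Longrightarrow> vars_below k (\<Prod>x\<in>A. f x)"
  by (induction A rule: infinite_finite_induct)
    (auto intro: vars_below_mult simp flip: single_one simp add: vars_below_single)

lemma vars_below_lvar: "j < k \<Longrightarrow> vars_below k (lvar j)"
  unfolding lvar_def by (rule vars_below_single) auto

lemma lookup_coeffwise: "D 0 = 0 \<Longrightarrow> lookup (coeffwise D Q) \<mu> = D (lookup Q \<mu>)"
  by (auto simp: coeffwise_def lookup_sum lookup_single when_def in_keys_iff)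

lemma coeffwise_single: "D 0 = 0 \<Longrightarrow> coeffwise D (single \<mu> v) = single \<mu> (D v)"
  unfolding coeffwise_def by (rule sum_keys_single) auto

lemma coeffwise_add:
  assumes "\<And>a b. D (a + b) = D a + D b"
  shows "coeffwise D (P + Q) = coeffwise D P + coeffwise D (Q :: 'v::comm_ring_1 lpoly)"
  by (rule poly_mapping_eqI) (simp add: lookup_coeffwise additive_zero[of D, OF assms] assms lookup_add)

lemma vars_below_coeffwise: "D 0 = 0 \<Longrightarrow> vars_below k Q \<Longrightarrow> vars_below k (coeffwise D Q)"
  by (auto simp: vars_below_def in_keys_iff lookup_coeffwise)

subsection \<open>The sign of a list\<close>

text \<open>For distinct entries this is -1 to the number of inversions, the sign of the sorting
  permutation. The head counts the smaller entries behind it, exactly as \<open>wedgeO\<close> does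
  when a generator is multiplied from the left onto a basis form.\<close>

fun list_sign :: "'a::linorder list \<Rightarrow> int" where
  "list_sign [] = 1"
| "list_sign (a # as) = (if a \<in> set as then 0 else (-1) ^ card {t \<in> set as. t < a} * list_sign as)"

lemma list_sign_not_distinct: "\<not> distinct as \<Longrightarrow> list_sign as = 0"
  by (induction as) auto

lemma list_sign_mult_self: "distinct as \<Longrightarrow> list_sign as * list_sign as = 1"
proof (induction as)
  case (Cons a as)
  then show ?case by (simp add: power_add[symmetric] algebra_simps)
qed simp

lemma list_sign_swap: "list_sign (a # b # as) = - list_sign (b # a # as)"
proof (cases "a = b \<or> a \<in> set as \<or> b \<in> set as")
  case False
  have "card {t \<in> insert b (set as). t < a} = card {t \<in> set as. t < a} + (if b < a then 1 else 0)"
    if "b \<notin> set as" for a b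
  proof -
    have "{t \<in> insert b (set as). t < a} = (if b < a then insert b else id) {t \<in> set as. t < a}" by auto
    then show ?thesis using that by (simp add: card_insert_if)
  qed
  with False show ?thesis
    by (cases a b rule: linorder_cases) auto
qed auto

text \<open>A prefix sees its tail only through the set of entries and the sign of the tail.\<close>

lemma list_sign_append_cong:
  assumes "set us = set vs" "list_sign us = c * list_sign vs"
  shows "list_sign (as @ us) = c * list_sign (as @ vs)"
  using assms by (induction as) auto

lemma list_sign_move: "list_sign (a # ys @ zs) = (-1) ^ length ys * list_sign (ys @ a # zs)"
proof (induction ys)
  case (Cons y ys)
  have "list_sign (a # y # ys @ zs) = - list_sign (y # a # ys @ zs)" by (rule list_sign_swap)
  also have "list_sign ([y] @ (a # ys @ zs)) = (-1) ^ length ys * list_sign ([y] @ (ys @ a # zs))"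
    by (rule list_sign_append_cong[OF _ Cons.IH]) auto
  then have "list_sign (y # a # ys @ zs) = (-1) ^ length ys * list_sign (y # ys @ a # zs)" by simp
  finally show ?case by simp
qed simp

text \<open>Carry \<open>a\<close> over \<open>ys\<close>, swap it with its neighbour
  \<open>b\<close>, carry \<open>b\<close> back: the two powers of -1 with exponent
  \<open>length ys\<close> cancel and one minus sign remains.\<close>

lemma list_sign_transpose: "list_sign (xs @ a # ys @ b # zs) = - list_sign (xs @ b # ys @ a # zs)"
proof -
  have "list_sign (a # ys @ b # zs) = (-1) ^ length ys * list_sign (ys @ a # b # zs)" by (rule list_sign_move)
  also have "list_sign (ys @ a # b # zs) = -1 * list_sign (ys @ b # a # zs)"
    by (rule list_sign_append_cong) (use list_sign_swap[of a b zs] in auto)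
  also have "(-1) ^ length ys * (-1 * list_sign (ys @ b # a # zs)) = - list_sign (b # ys @ a # zs)"
    unfolding list_sign_move[of b ys "a # zs"] by simp
  finally have "list_sign (a # ys @ b # zs) = -1 * list_sign (b # ys @ a # zs)" by simp
  from list_sign_append_cong[OF _ this, of xs] show ?thesis by auto
qed

lemma permute_list_transpose:
  assumes "i < j" "j < length as"
  shows "\<exists>xs ys zs. as = xs @ as ! i # ys @ as ! j # zs \<and>
    permute_list (transpose i j) as = xs @ as ! j # ys @ as ! i # zs"
proof -
  define xs where "xs = take i as"
  define ys where "ys = take (j - i - 1) (drop (Suc i) as)"
  define zs where "zs = drop (Suc j) as"
  have "drop (Suc i) as = ys @ drop (j - i - 1) (drop (Suc i) as)"
    unfolding ys_def by (rule append_take_drop_id[symmetric])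
  also have "drop (j - i - 1) (drop (Suc i) as) = as ! j # zs"
    using assms by (simp add: zs_def Cons_nth_drop_Suc)
  finally have as: "as = xs @ as ! i # ys @ as ! j # zs"
    using assms unfolding xs_def by (metis id_take_nth_drop order_less_trans)
  have len: "length xs = i" "length ys = j - i - 1" using assms by (simp_all add: xs_def ys_def)
  have "permute_list (transpose i j) (xs @ a # ys @ b # zs) = xs @ b # ys @ a # zs" for a b
  proof (rule nth_equalityI)
    fix l assume l: "l < length (permute_list (transpose i j) (xs @ a # ys @ b # zs))"
    consider "l < i" | "l = i" | m where "l = Suc i + m" "l < j" | "l = j" | m where "l = Suc j + m"
      by (metis less_iff_Suc_add linorder_neqE_nat add_Suc)
    then show "permute_list (transpose i j) (xs @ a # ys @ b # zs) ! l = (xs @ b # ys @ a # zs) ! l"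
      using l assms len
      by cases (auto simp: permute_list_def transpose_def nth_append nth_Cons' simp del: upt_Suc)
  qed simp
  with as show ?thesis by metis
qed

lemma list_sign_permute:
  fixes as :: "'a::linorder list"
  assumes "p permutes {..<length as}"
  shows "list_sign (permute_list p as) = sign p * list_sign as"
proof -
  \<comment> \<open>The list is quantified inside the induction over transpositions: permuting by
    \<open>transpose a b \<circ> p\<close> means exchanging two entries and then applying
    \<open>p\<close>, so the hypothesis is used for the exchanged list.\<close>
  have "\<forall>as::'a list. length as = n \<longrightarrow> list_sign (permute_list p as) = sign p * list_sign as" if "p permutes {..<n}" for n
    using that finite_lessThan
  proof (induction rule: permutes_induct)
    case id
    then show ?case by simp
  next
    case (swap a b p)
    show ?case
    proof (intro allI impI)
      fix as :: "'a list" assume len: "length as = n"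
      have tr: "list_sign (permute_list (transpose i j) as) = - list_sign as" if "i < j" "j < n" for i j
      proof -
        from permute_list_transpose[of i j as] that len obtain xs ys zs where
          "as = xs @ as ! i # ys @ as ! j # zs"
          "permute_list (transpose i j) as = xs @ as ! j # ys @ as ! i # zs" by blast
        then show ?thesis using list_sign_transpose[of xs "as ! j" ys "as ! i" zs] by simp
      qed
      have "list_sign (permute_list (transpose a b) as) = - list_sign as"
      proof (cases a b rule: linorder_cases)
        case less
        then show ?thesis using tr swap.hyps by blast
      next
        case greater
        then show ?thesis using tr[of b a] swap.hyps by (simp add: transpose_commute)
      qed (use swap.hyps in blast)
      moreover have "sign (transpose a b \<circ> p) = - sign p"
      proof -
        have "permutation p" using swap.hyps by (auto simp: permutation_permutes)
        with swap.hyps show ?thesis by (simp add: sign_compose sign_swap_id permutation_swap_id)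
      qed
      moreover have "list_sign (permute_list p (permute_list (transpose a b) as)) =
          sign p * list_sign (permute_list (transpose a b) as)"
        using swap.IH len by simp
      moreover have "permute_list (transpose a b \<circ> p) as = permute_list p (permute_list (transpose a b) as)"
        using swap.hyps len by (intro permute_list_compose) auto
      ultimately show "list_sign (permute_list (transpose a b \<circ> p) as) = sign (transpose a b \<circ> p) * list_sign as"
        by simp
    qed
  qed
  with assms show ?thesis by blast
qed

text \<open>Inversions of a concatenation lie within one part or between the two. The latter are the
  pairs counted by \<open>wedgeO\<close>, so products of generators will be multiplicative under
  concatenation.\<close>

lemma list_sign_append:
  "list_sign (xs @ ys) = (if set xs \<inter> set ys = {}
     then (-1) ^ card {(s, t). s \<in> set xs \<and> t \<in> set ys \<and> t < s} * list_sign xs * list_sign ys else 0)"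
proof (induction xs)
  case (Cons a xs)
  show ?case
  proof (cases "a \<in> set xs \<or> a \<in> set ys \<or> set xs \<inter> set ys \<noteq> {}")
    case False
    have "{t \<in> set (xs @ ys). t < a} = {t \<in> set xs. t < a} \<union> {t \<in> set ys. t < a}" by auto
    then have 1: "card {t \<in> set (xs @ ys). t < a} = card {t \<in> set xs. t < a} + card {t \<in> set ys. t < a}"
      using False by (simp add: card_Un_disjoint disjoint_iff)
    let ?Y = "{(s, t). s \<in> set xs \<and> t \<in> set ys \<and> t < s}"
    have eq: "{(s, t). s \<in> set (a # xs) \<and> t \<in> set ys \<and> t < s} = Pair a ` {t \<in> set ys. t < a} \<union> ?Y"
      by auto
    have "finite ?Y" by (rule finite_subset[of _ "set xs \<times> set ys"]) auto
    moreover have "Pair a ` {t \<in> set ys. t < a} \<inter> ?Y = {}" using False by blast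
    ultimately have 2: "card {(s, t). s \<in> set (a # xs) \<and> t \<in> set ys \<and> t < s} =
        card {t \<in> set ys. t < a} + card ?Y"
      unfolding eq by (subst card_Un_disjoint) (simp_all add: card_image inj_on_def)
    have "list_sign ((a # xs) @ ys) = (-1) ^ card {t \<in> set (xs @ ys). t < a} * list_sign (xs @ ys)"
      using False by simp
    also have "\<dots> = (-1) ^ card {(s, t). s \<in> set (a # xs) \<and> t \<in> set ys \<and> t < s} * list_sign (a # xs) * list_sign ys"
      using False unfolding 1 2 Cons by (simp add: power_add)
    finally show ?thesis using False by simp
  next
    case True
    then have "\<not> distinct ((a # xs) @ ys)" by auto
    then have "list_sign ((a # xs) @ ys) = 0" by (rule list_sign_not_distinct)
    with True show ?thesis by auto
  qed
qed simp

lemma list_sign_sorted: "sorted as \<Longrightarrow> distinct as \<Longrightarrow> list_sign as = 1"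
proof (induction as)
  case (Cons a as)
  then have e: "{t \<in> set as. t < a} = {}" by auto
  show ?case using Cons unfolding list_sign.simps e by simp
qed simp

section \<open>Alternating functions of lists\<close>

lemma distinct_permute_sorted:
  assumes "distinct as"
  obtains p where "p permutes {..<length as}" "permute_list p (sorted_list_of_set (set as)) = as" "sign p = list_sign as"
proof -
  have "mset as = mset (sorted_list_of_set (set as))"
    using assms by (intro set_eq_iff_mset_eq_distinct[THEN iffD1]) auto
  then obtain p where "p permutes {..<length (sorted_list_of_set (set as))}"
    "permute_list p (sorted_list_of_set (set as)) = as" by (rule mset_eq_permutation)
  moreover have "length (sorted_list_of_set (set as)) = length as"
    using assms by (simp add: distinct_card)
  moreover have "list_sign (sorted_list_of_set (set as)) = 1" by (rule list_sign_sorted) auto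
  ultimately show ?thesis using that list_sign_permute by (metis mult.right_neutral)
qed

text \<open>Exchanging the positions of two equal entries fixes the list, so
  \<open>f as = - f as\<close>; absence of 2-torsion turns this into
  \<open>f as = 0\<close>.\<close>

lemma alternating_repeat:
  fixes f :: "'a list \<Rightarrow> 'v::comm_ring_1"
  assumes tf: "\<And>x::'v. x + x = 0 \<Longrightarrow> x = 0"
    and alt: "\<And>p. p permutes {..<length as} \<Longrightarrow> f (permute_list p as) = of_int (sign p) * f as"
    and "\<not> distinct as"
  shows "f as = 0"
proof -
  from assms obtain i j where ij: "i < j" "j < length as" "as ! i = as ! j"
    unfolding distinct_conv_nth by (metis linorder_neqE_nat)
  from permute_list_transpose[OF ij(1,2)] ij have "permute_list (transpose i j) as = as" by metis
  moreover have "transpose i j permutes {..<length as}" using ij by (intro permutes_swap_id) auto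
  ultimately have "f as = of_int (sign (transpose i j)) * f as" using alt by metis
  then have "f as + f as = 0" using ij by (simp add: sign_swap_id)
  then show ?thesis by (rule tf)
qed

text \<open>A distinct list is a permutation of its increasing one, with sign
  \<open>list_sign\<close>. On a list with a repetition both sides are 0, although the sorted list
  of its set is then shorter than \<open>k\<close>.\<close>

lemma alternating_eq:
  fixes f :: "'a::linorder list \<Rightarrow> 'v::comm_ring_1"
  assumes tf: "\<And>x::'v. x + x = 0 \<Longrightarrow> x = 0"
    and alt: "\<And>as p. length as = k \<Longrightarrow> p permutes {..<k} \<Longrightarrow> f (permute_list p as) = of_int (sign p) * f as"
    and len: "length as = k"
  shows "f as = of_int (list_sign as) * f (sorted_list_of_set (set as))"
proof (cases "distinct as")
  case True
  from distinct_permute_sorted[OF True] obtain p where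
    "p permutes {..<length as}" "permute_list p (sorted_list_of_set (set as)) = as" "sign p = list_sign as" .
  moreover have "length (sorted_list_of_set (set as)) = k" using True len by (simp add: distinct_card)
  ultimately show ?thesis using alt len by metis
next
  case False
  then show ?thesis using alternating_repeat[OF tf, of as f] alt len by (simp add: list_sign_not_distinct)
qed

subsection \<open>Differential forms\<close>

lemma lookup_scO: "lookup (scO f \<omega>) S = f * lookup \<omega> S"
  by (auto simp: scO_def lookup_sum lookup_single when_def in_keys_iff)

lemma scO_single: "scO f (single S a) = single S (f * a)"
  by (rule poly_mapping_eqI) (simp add: lookup_scO lookup_single when_def)

lemma scO_add: "scO f (\<omega> + \<eta>) = scO f \<omega> + scO f \<eta>"
  by (rule poly_mapping_eqI) (simp add: lookup_scO lookup_add distrib_left)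

lemma scO_add_left: "scO (f + g) \<omega> = scO f \<omega> + scO g \<omega>"
  by (rule poly_mapping_eqI) (simp add: lookup_scO lookup_add distrib_right)

lemma scO_zero [simp]: "scO f 0 = 0" "scO 0 \<omega> = 0"
  by (auto intro!: poly_mapping_eqI simp: lookup_scO)

lemma scO_scO: "scO f (scO g \<omega>) = scO (f * g) \<omega>"
  by (rule poly_mapping_eqI) (simp add: lookup_scO mult.assoc)

lemma scO_one: "scO 1 \<omega> = \<omega>"
  by (rule poly_mapping_eqI) (simp add: lookup_scO)

lemmas scO_sum = additive_sum[of "scO f" for f, OF scO_add]

lemma wedgeO_single:
  "wedgeO (single S a) (single T b) = (if S \<inter> T = {} then
     single (S \<union> T) ((-1) ^ card {(s, t). s \<in> S \<and> t \<in> T \<and> t < s} * a * b) else 0)"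
  unfolding wedgeO_def
  by (subst sum_keys_single, simp)+ simp

lemma wedgeO_add_left: "wedgeO (\<omega> + \<omega>') \<eta> = wedgeO \<omega> \<eta> + wedgeO \<omega>' \<eta>"
  unfolding wedgeO_def
  by (rule sum_keys_add) (auto simp: distrib_left distrib_right single_add sum.distrib[symmetric] intro!: sum.cong sum.neutral)

lemma wedgeO_add_right: "wedgeO \<omega> (\<eta> + \<eta>') = wedgeO \<omega> \<eta> + wedgeO \<omega> \<eta>'"
  unfolding wedgeO_def sum.distrib[symmetric]
  by (rule sum.cong[OF refl], rule sum_keys_add) (auto simp: distrib_left single_add)

lemmas wedgeO_sum_left = additive_sum[of "\<lambda>\<omega>. wedgeO \<omega> \<eta>" for \<eta>, OF wedgeO_add_left]
lemmas wedgeO_sum_right = additive_sum[of "wedgeO \<omega>" for \<omega>, OF wedgeO_add_right]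

lemma wedgeO_genO_single:
  "wedgeO (single {g} c) (single S a) =
    (if g \<in> S then 0 else single (insert g S) ((-1) ^ card {t \<in> S. t < g} * c * a))"
proof -
  have "{(s, t). s \<in> {g} \<and> t \<in> S \<and> t < s} = Pair g ` {t \<in> S. t < g}" by auto
  then show ?thesis by (simp add: wedgeO_single card_image inj_on_def)
qed

lemma wedge_list_Cons: "wedge_list (g # gs) = wedgeO (genO g) (wedge_list gs)"
  by (simp add: wedge_list_def)

text \<open>Both sides obey the same recursion, including the value 0 once a generator
  repeats.\<close>

lemma wedge_list_eq: "wedge_list gs = single (set gs) (of_int (list_sign gs))"
proof (induction gs)
  case Nil
  then show ?case by (simp add: wedge_list_def oneO_def)
next
  case (Cons g gs)
  then show ?case unfolding wedge_list_Cons genO_def by (simp add: wedgeO_genO_single)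
qed

lemma lookup_wedge_list: "lookup (wedge_list gs) S = (of_int (list_sign gs) when set gs = S)"
  by (simp add: wedge_list_eq lookup_single)

lemma wedge_list_append: "wedge_list (xs @ ys) = wedgeO (wedge_list xs) (wedge_list ys)"
  by (simp add: wedge_list_eq wedgeO_single list_sign_append)

subsection \<open>Coefficients of cochains\<close>

text \<open>The family f with its rows of indices i and exponents m merged into one list of
  generators (i, m). Simultaneous permutation of arguments and variables thus becomes permutation of
  one list.\<close>

definition cochain_coeff :: "('i, 'f::field_char_0, 'v::comm_ring_1) cochain \<Rightarrow> ('i \<times> nat) list \<Rightarrow> 'v" where
  "cochain_coeff \<gamma> gs = lookup (\<gamma> (map (\<lambda>g. gen_u (fst g)) gs)) (mon_of_list (map snd gs))"

text \<open>There are finitely many index lists because I is finite, and each polynomial has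
  finitely many monomials; \<open>mon_of_list\<close> is injective on lists of fixed length.\<close>

lemma finite_cochain_coeff:
  fixes \<gamma> :: "('i::finite, 'f::field_char_0, 'v::comm_ring_1) cochain"
  shows "finite {gs. length gs = k \<and> cochain_coeff \<gamma> gs \<noteq> 0}"
proof -
  let ?I = "{is :: 'i list. set is \<subseteq> UNIV \<and> length is = k}"
  let ?M = "\<lambda>is. {ms. length ms = k \<and> mon_of_list ms \<in> keys (\<gamma> (map gen_u is))}"
  have "finite (?M is)" for "is"
  proof (rule finite_imageD)
    show "finite (mon_of_list ` ?M is)" by (rule finite_subset[of _ "keys (\<gamma> (map gen_u is))"]) auto
    show "inj_on mon_of_list (?M is)" by (auto simp: inj_on_def mon_of_list_eq_iff)
  qed
  moreover have "finite ?I" by (rule finite_lists_length_eq) simp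
  ultimately have "finite (\<Union>is\<in>?I. zip is ` ?M is)" by blast
  moreover have "{gs. length gs = k \<and> cochain_coeff \<gamma> gs \<noteq> 0} \<subseteq> (\<Union>is\<in>?I. zip is ` ?M is)"
  proof
    fix gs assume "gs \<in> {gs. length gs = k \<and> cochain_coeff \<gamma> gs \<noteq> 0}"
    then have "map fst gs \<in> ?I" "map snd gs \<in> ?M (map fst gs)"
      by (auto simp: cochain_coeff_def in_keys_iff comp_def)
    moreover have "gs = zip (map fst gs) (map snd gs)" by (simp add: zip_map_fst_snd)
    ultimately show "gs \<in> (\<Union>is\<in>?I. zip is ` ?M is)" by blast
  qed
  ultimately show ?thesis by (rule finite_subset[rotated])
qed

section \<open>Rational constants in V and the components of \<open>Phi\<close>\<close>

locale scalars =
  fixes emb :: "'f::field_char_0 \<Rightarrow> 'v::comm_ring_1"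
  assumes hom: "is_ring_hom_emb emb"
begin

lemma emb_one: "emb 1 = 1"
  and emb_add: "emb (a + b) = emb a + emb b"
  and emb_mult: "emb (a * b) = emb a * emb b"
  using hom by (auto simp: is_ring_hom_emb_def)

lemmas emb_zero = additive_zero[of emb, OF emb_add]

lemma emb_of_nat: "emb (of_nat n) = of_nat n"
  by (induction n) (simp_all add: emb_zero emb_add emb_one)

lemma emb_inverse_fact: "emb (1 / fact k) * of_nat (fact k) = 1"
proof -
  have "emb (1 / fact k) * of_nat (fact k) = emb (1 / fact k * of_nat (fact k))"
    by (simp only: emb_mult emb_of_nat)
  also have "\<dots> = 1" by (simp add: emb_one)
  finally show ?thesis .
qed

lemma poly_neg_var_gen_u: "poly_neg_var emb (gen_u c c') j = (if c' = c then 1 else 0)"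
  by (simp add: poly_neg_var_def gen_u_def emb_one emb_zero)

text \<open>The image of 1/2! under \<open>emb\<close> is an inverse of 2; this is how
  characteristic 0 of the field reaches V.\<close>

lemma torsion_free:
  assumes "x + x = (0 :: 'v)"
  shows "x = 0"
proof -
  have "x = emb (1 / fact 2) * of_nat (fact 2) * x" by (simp only: emb_inverse_fact mult_1)
  also have "\<dots> = emb (1 / fact 2) * (x + x)" by (simp add: fact_2 algebra_simps)
  finally show ?thesis using assms by simp
qed

text \<open>Replaces \<open>Sum_any\<close> by a sum over any finite set of lists that contains the
  support. The separate clause of \<open>Phi\<close> for k = 0 is absorbed: the empty list is then
  the only one, and 0! = 1.\<close>

lemma Phi_eq_sum:
  fixes \<gamma> :: "('i::{finite, linorder}, 'f, 'v) cochain"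
  assumes "finite A" "\<And>gs. gs \<in> A \<Longrightarrow> length gs = k" "\<And>gs. length gs = k \<Longrightarrow> cochain_coeff \<gamma> gs \<noteq> 0 \<Longrightarrow> gs \<in> A"
  shows "Phi emb k \<gamma> = scO (emb (1 / fact k)) (\<Sum>gs\<in>A. scO (cochain_coeff \<gamma> gs) (wedge_list gs))"
proof -
  have S: "Sum_any (\<lambda>gs. if length gs = k then scO (cochain_coeff \<gamma> gs) (wedge_list gs) else 0) =
      (\<Sum>gs\<in>A. scO (cochain_coeff \<gamma> gs) (wedge_list gs))" (is "?S = _")
  proof (subst Sum_any.expand_superset[of A])
    show "{gs. (if length gs = k then scO (cochain_coeff \<gamma> gs) (wedge_list gs) else 0) \<noteq> 0} \<subseteq> A"
      using assms(3) by (auto split: if_splits) (metis scO_zero(2))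
  qed (use assms in \<open>auto intro: sum.cong\<close>)
  show ?thesis
  proof (cases "k = 0")
    case True
    have "?S = (\<Sum>gs\<in>{[]}. scO (cochain_coeff \<gamma> gs) (wedge_list gs))"
      using True by (subst Sum_any.expand_superset[of "{[]}"]) (auto split: if_splits)
    then have "?S = single {} (lookup (\<gamma> []) 0)"
      by (simp add: cochain_coeff_def mon_of_list_def wedge_list_eq scO_single)
    then show ?thesis using True S by (simp add: Phi_def emb_one scO_one)
  next
    case False
    then have "Phi emb k \<gamma> = scO (emb (1 / fact k)) ?S" unfolding Phi_def cochain_coeff_def by simp
    then show ?thesis by (simp only: S)
  qed
qed

lemma Phi_eq:
  fixes \<gamma> :: "('i::{finite, linorder}, 'f, 'v) cochain"
  shows "Phi emb k \<gamma> = scO (emb (1 / fact k))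
    (\<Sum>gs | length gs = k \<and> cochain_coeff \<gamma> gs \<noteq> 0. scO (cochain_coeff \<gamma> gs) (wedge_list gs))"
  by (rule Phi_eq_sum) (auto intro: finite_cochain_coeff)

lemma Phi_in_Omega_t: "Phi emb k \<gamma> \<in> Omega_t k"
proof -
  have "finite S \<and> card S = k" if "lookup (Phi emb k \<gamma>) S \<noteq> 0" for S
  proof -
    have "\<exists>gs. length gs = k \<and> cochain_coeff \<gamma> gs * (of_int (list_sign gs) when set gs = S) \<noteq> 0"
    proof (rule ccontr)
      assume "\<nexists>gs. length gs = k \<and> cochain_coeff \<gamma> gs * (of_int (list_sign gs) when set gs = S) \<noteq> 0"
      then have "(\<Sum>gs | length gs = k \<and> cochain_coeff \<gamma> gs \<noteq> 0. cochain_coeff \<gamma> gs * (of_int (list_sign gs) when set gs = S)) = 0"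
        by (intro sum.neutral) auto
      with that show False by (simp add: Phi_eq lookup_scO lookup_sum lookup_wedge_list)
    qed
    then obtain gs where gs: "length gs = k" "cochain_coeff \<gamma> gs * (of_int (list_sign gs) when set gs = S) \<noteq> 0" by blast
    then have "set gs = S" "list_sign gs \<noteq> 0" by (auto simp: when_def split: if_splits)
    with gs show ?thesis using list_sign_not_distinct distinct_card by blast
  qed
  then show ?thesis by (simp add: Omega_t_def in_keys_iff)
qed

lemma Omega_t_lookup: "\<omega> \<in> Omega_t k \<Longrightarrow> \<not> (finite S \<and> card S = k) \<Longrightarrow> lookup \<omega> S = 0"
  by (auto simp: Omega_t_def in_keys_iff)

lemma Omega_t_eqI:
  assumes "\<omega> \<in> Omega_t k" "\<eta> \<in> Omega_t k"
    and "\<And>S. finite S \<Longrightarrow> card S = k \<Longrightarrow> lookup \<omega> S = lookup \<eta> S"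
  shows "\<omega> = \<eta>"
  by (rule poly_mapping_eqI) (metis assms Omega_t_lookup)

lemma lookup_Phi:
  assumes "finite S"
  shows "lookup (Phi emb k \<gamma>) S =
    emb (1 / fact k) * (\<Sum>gs | length gs = k \<and> set gs = S. cochain_coeff \<gamma> gs * of_int (list_sign gs))"
proof -
  let ?A = "{gs. length gs = k \<and> cochain_coeff \<gamma> gs \<noteq> 0}" and ?B = "{gs. length gs = k \<and> set gs = S}"
  have B: "finite ?B"
    by (rule finite_subset[OF _ finite_lists_length_eq[OF assms, of k]]) auto
  have "(\<Sum>gs\<in>?A. cochain_coeff \<gamma> gs * (of_int (list_sign gs) when set gs = S)) = (\<Sum>gs\<in>?B. cochain_coeff \<gamma> gs * of_int (list_sign gs))"
    by (rule sum.mono_neutral_cong[OF B finite_cochain_coeff]) (auto simp: when_def)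
  then show ?thesis by (simp add: Phi_eq lookup_scO lookup_sum lookup_wedge_list)
qed

text \<open>The sign squares to 1, so each enumeration of \<open>S\<close> contributes
  \<open>c\<close>. Only enumerations of \<open>S\<close> are tested, so an explicit coefficient
  formula for a contraction or a differential can be inserted directly.\<close>

lemma lookup_Phi_alternating:
  assumes "finite S" "card S = k"
    and "\<And>gs. distinct gs \<Longrightarrow> set gs = S \<Longrightarrow> cochain_coeff \<gamma> gs = of_int (list_sign gs) * c"
  shows "lookup (Phi emb k \<gamma>) S = c"
proof -
  have eq: "{gs. length gs = k \<and> set gs = S} = permutations_of_set S"
    using assms(2) by (auto simp: permutations_of_set_def distinct_card intro: card_distinct)
  have "cochain_coeff \<gamma> gs * of_int (list_sign gs) = c" if "gs \<in> permutations_of_set S" for gs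
  proof -
    have gs: "set gs = S" "distinct gs" using that by (auto simp: permutations_of_set_def)
    have "cochain_coeff \<gamma> gs * of_int (list_sign gs) = of_int (list_sign gs * list_sign gs) * c"
      unfolding assms(3)[OF gs(2,1)] of_int_mult by (simp only: ac_simps)
    then show ?thesis by (simp add: list_sign_mult_self[OF gs(2)])
  qed
  then have "(\<Sum>gs\<in>permutations_of_set S. cochain_coeff \<gamma> gs * of_int (list_sign gs)) = of_nat (fact k) * c"
    using assms(1,2) by simp
  then show ?thesis
    using emb_inverse_fact[of k] unfolding lookup_Phi[OF assms(1)] eq
    by (metis mult.assoc mult_1)
qed

lemma Phi_add:
  fixes \<alpha> \<beta> :: "('i::{finite, linorder}, 'f, 'v) cochain"
  shows "Phi emb k (\<lambda>as. \<alpha> as + \<beta> as) = Phi emb k \<alpha> + Phi emb k \<beta>"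
proof (rule poly_mapping_eqI)
  fix S
  have cochain_coeff: "cochain_coeff (\<lambda>as. \<alpha> as + \<beta> as) gs = cochain_coeff \<alpha> gs + cochain_coeff \<beta> gs" for gs
    by (simp add: cochain_coeff_def lookup_add)
  show "lookup (Phi emb k (\<lambda>as. \<alpha> as + \<beta> as)) S = lookup (Phi emb k \<alpha> + Phi emb k \<beta>) S"
  proof (cases "finite S")
    case True
    then show ?thesis
      by (simp only: lookup_Phi lookup_add cochain_coeff sum.distrib distrib_left distrib_right)
  next
    case False
    have "lookup (Phi emb k \<gamma>) S = 0" for \<gamma> :: "('i, 'f, 'v) cochain"
      by (rule Omega_t_lookup[OF Phi_in_Omega_t]) (simp add: False)
    then show ?thesis by (simp add: lookup_add)
  qed
qed

end

section \<open>The cochain axioms and the alternation of coefficients\<close>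

lemma Gamma_t_length:
  assumes "\<gamma> \<in> Gamma_t emb k" "length as \<noteq> k"
  shows "\<gamma> as = 0"
  using assms(1)[unfolded Gamma_t_def mem_Collect_eq, THEN conjunct1] assms(2-) by blast

lemma Gamma_t_vars:
  assumes "\<gamma> \<in> Gamma_t emb k" "length as = k"
  shows "vars_below k (\<gamma> as)"
  using assms(1)[unfolded Gamma_t_def mem_Collect_eq, THEN conjunct2, THEN conjunct1] assms(2-) by blast

lemma Gamma_t_add:
  assumes "\<gamma> \<in> Gamma_t emb k" "length as = k" "j < k"
  shows "\<gamma> (as[j := (\<lambda>i. b i + c i)]) = \<gamma> (as[j := b]) + \<gamma> (as[j := c])"
  using assms(1)[unfolded Gamma_t_def mem_Collect_eq, THEN conjunct2, THEN conjunct2, THEN conjunct1] assms(2-) by blast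

lemma Gamma_t_smult:
  assumes "\<gamma> \<in> Gamma_t emb k" "length as = k" "j < k"
  shows "\<gamma> (as[j := smultA s b]) = lconst (emb s) * \<gamma> (as[j := b])"
  using assms(1)[unfolded Gamma_t_def mem_Collect_eq, THEN conjunct2, THEN conjunct2, THEN conjunct2, THEN conjunct1] assms(2-) by blast

lemma Gamma_t_dA:
  assumes "\<gamma> \<in> Gamma_t emb k" "length as = k" "j < k"
  shows "\<gamma> (as[j := dA (as ! j)]) = - (lvar j * \<gamma> as)"
  using assms(1)[unfolded Gamma_t_def mem_Collect_eq, THEN conjunct2, THEN conjunct2, THEN conjunct2, THEN conjunct2, THEN conjunct1] assms(2-) by blast

lemma Gamma_t_permute:
  assumes "\<gamma> \<in> Gamma_t emb k" "length as = k" "p permutes {..<k}"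
  shows "ren p (\<gamma> (permute_list p as)) = lconst (of_int (sign p)) * \<gamma> as"
  using assms(1)[unfolded Gamma_t_def mem_Collect_eq, THEN conjunct2, THEN conjunct2, THEN conjunct2, THEN conjunct2, THEN conjunct2] assms(2-) unfolding permute_list_def by blast

lemma vars_below_Gamma_t: "\<gamma> \<in> Gamma_t emb k \<Longrightarrow> vars_below k (\<gamma> as)"
  using Gamma_t_length Gamma_t_vars by (cases "length as = k") fastforce+

lemma lookup_ren_mon_of_list:
  assumes "vars_below k Q" "inj_on \<rho> {..<k}" "\<rho> ` {..<k} = {..<length ms}"
  shows "lookup (ren \<rho> Q) (mon_of_list ms) = lookup Q (mon_of_list (map (\<lambda>j. ms ! \<rho> j) [0..<k]))"
proof -
  have "map (\<lambda>j. lookup (mon_of_list ms) (\<rho> j)) [0..<k] = map (\<lambda>j. ms ! \<rho> j) [0..<k]"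
    using assms(3) by (auto simp: lookup_mon_of_list)
  with keys_mon_of_list[of ms] show ?thesis
    by (simp only: lookup_ren[OF assms(2,1)] assms(3) if_True)
qed

text \<open>A coefficient of a polynomial renamed by \<open>p\<close> is the coefficient of the
  original at the exponents permuted by \<open>p\<close>; arguments and exponents therefore move
  together.\<close>

lemma cochain_coeff_permute:
  fixes \<gamma> :: "('i, 'f::field_char_0, 'v::comm_ring_1) cochain"
  assumes "\<gamma> \<in> Gamma_t emb k" "length gs = k" "p permutes {..<k}"
  shows "cochain_coeff \<gamma> (permute_list p gs) = of_int (sign p) * cochain_coeff \<gamma> gs"
proof -
  let ?as = "map (\<lambda>g. gen_u (fst g)) gs :: ('i, 'f) amod list"
  have "lookup (ren p (\<gamma> (permute_list p ?as))) (mon_of_list (map snd gs)) =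
      lookup (\<gamma> (permute_list p ?as)) (mon_of_list (permute_list p (map snd gs)))"
    using assms
    by (subst lookup_ren_mon_of_list[where k = k])
      (auto simp: vars_below_Gamma_t permutes_inj_on permutes_image permute_list_def)
  moreover have "permute_list p ?as = map (\<lambda>g. gen_u (fst g)) (permute_list p gs)"
    "permute_list p (map snd gs) = map snd (permute_list p gs)"
    using assms by (simp_all add: permute_list_map)
  moreover have "length ?as = k" using assms by simp
  ultimately show ?thesis
    using assms Gamma_t_permute[OF assms(1) \<open>length ?as = k\<close> assms(3)]
    by (simp only: cochain_coeff_def lookup_lconst_mult)
qed

text \<open>The inverse formula: a component of the form determines the coefficients on all
  orderings of its set. It yields injectivity and lets computations with \<open>\<gamma>\<close> be
  rewritten in terms of the form.\<close>

lemma (in scalars) cochain_coeff_eq_lookup_Phi: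
  fixes \<gamma> :: "('i::{finite, linorder}, 'f, 'v) cochain"
  assumes "\<gamma> \<in> Gamma_t emb k" "length gs = k"
  shows "cochain_coeff \<gamma> gs = of_int (list_sign gs) * lookup (Phi emb k \<gamma>) (set gs)"
proof (cases "distinct gs")
  case True
  have eq: "cochain_coeff \<gamma> hs = of_int (list_sign hs) * cochain_coeff \<gamma> (sorted_list_of_set (set hs))" if "length hs = k" for hs
    by (rule alternating_eq[OF torsion_free cochain_coeff_permute[OF assms(1)]]) (use that in auto)
  have "lookup (Phi emb k \<gamma>) (set gs) = cochain_coeff \<gamma> (sorted_list_of_set (set gs))"
  proof (rule lookup_Phi_alternating)
    show "card (set gs) = k" using True assms by (simp add: distinct_card)
    then show "cochain_coeff \<gamma> hs = of_int (list_sign hs) * cochain_coeff \<gamma> (sorted_list_of_set (set gs))"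
      if "distinct hs" "set hs = set gs" for hs
      using eq[of hs] that by (metis distinct_card)
  qed simp
  then show ?thesis using eq[OF assms(2)] by simp
next
  case False
  have "cochain_coeff \<gamma> gs = 0"
    by (rule alternating_repeat[OF torsion_free _ False])
      (use cochain_coeff_permute[OF assms(1,2)] assms(2) in auto)
  then show ?thesis using False by (simp add: list_sign_not_distinct)
qed

subsection \<open>Contraction\<close>

lemma lookup_mon_tl: "lookup (mon_tl \<mu>) i = lookup \<mu> (Suc i)"
proof -
  have "lookup (mon_tl \<mu>) i = (\<Sum>j\<in>keys \<mu> - {0}. if j = Suc i then lookup \<mu> (Suc i) else 0)"
    unfolding mon_tl_def lookup_sum lookup_single
    by (rule sum.cong) (auto simp: when_def)
  then show ?thesis by (auto simp: in_keys_iff)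
qed

lemma mon_tl_eq_iff: "mon_tl \<mu> = mon_of_list ms \<longleftrightarrow> \<mu> = mon_of_list (lookup \<mu> 0 # ms)"
proof
  assume a: "mon_tl \<mu> = mon_of_list ms"
  show "\<mu> = mon_of_list (lookup \<mu> 0 # ms)"
  proof (rule poly_mapping_eqI)
    fix i show "lookup \<mu> i = lookup (mon_of_list (lookup \<mu> 0 # ms)) i"
    proof (cases i)
      case (Suc j)
      have "lookup \<mu> (Suc j) = lookup (mon_of_list ms) j" by (simp add: a[symmetric] lookup_mon_tl)
      then show ?thesis by (simp add: Suc lookup_mon_of_list)
    qed (simp add: lookup_mon_of_list)
  qed
next
  assume a: "\<mu> = mon_of_list (lookup \<mu> 0 # ms)"
  show "mon_tl \<mu> = mon_of_list ms"
    by (rule poly_mapping_eqI, subst lookup_mon_tl, subst a) (simp add: lookup_mon_of_list)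
qed

lemma Omega_t_zero: "0 \<in> Omega_t k"
  and Omega_t_add: "\<omega> \<in> Omega_t k \<Longrightarrow> \<eta> \<in> Omega_t k \<Longrightarrow> \<omega> + \<eta> \<in> Omega_t k"
  and Omega_t_single: "finite S \<and> card S = k \<Longrightarrow> single S a \<in> Omega_t k"
  using keys_add[of \<omega> \<eta>] by (auto simp: Omega_t_def)

lemma Omega_t_sum: "(\<And>x. x \<in> A \<Longrightarrow> f x \<in> Omega_t k) \<Longrightarrow> (\<Sum>x\<in>A. f x) \<in> Omega_t k"
  by (induction A rule: infinite_finite_induct) (auto intro: Omega_t_zero Omega_t_add)

lemma Omega_t_keysD: "\<omega> \<in> Omega_t k \<Longrightarrow> S \<in> keys \<omega> \<Longrightarrow> finite S \<and> card S = k"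
  by (simp add: Omega_t_def)

lemma iotaO_in_Omega_t:
  assumes "\<omega> \<in> Omega_t (Suc k)"
  shows "iotaO P \<omega> \<in> Omega_t k"
  unfolding iotaO_def
proof (intro Omega_t_sum)
  fix S s assume "S \<in> keys \<omega>" "s \<in> S"
  then show "single (S - {s}) ((-1) ^ card {t \<in> S. t < s} * P (fst s) (snd s) * lookup \<omega> S) \<in> Omega_t k"
    using Omega_t_keysD[OF assms] by (intro Omega_t_single) fastforce
qed

text \<open>The component at \<open>U\<close> collects the components at \<open>insert s U\<close>
  with \<open>s\<close> outside \<open>U\<close>. There are infinitely many such \<open>s\<close>;
  \<open>G\<close> is a finite set containing those that meet the support.\<close>

lemma lookup_iotaO:
  assumes "\<omega> \<in> Omega_t k" "finite G" "\<And>s. s \<notin> U \<Longrightarrow> insert s U \<in> keys \<omega> \<Longrightarrow> s \<in> G"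
  shows "lookup (iotaO P \<omega>) U =
    (\<Sum>s\<in>G - U. (-1) ^ card {t \<in> U. t < s} * P (fst s) (snd s) * lookup \<omega> (insert s U))"
proof -
  let ?g = "\<lambda>s. (-1) ^ card {t \<in> U. t < s} * P (fst s) (snd s) * lookup \<omega> (insert s U)"
  have inner: "(\<Sum>s\<in>S. (-1) ^ card {t \<in> S. t < s} * P (fst s) (snd s) * lookup \<omega> S when S - {s} = U) =
      (\<Sum>s\<in>G - U. if S = insert s U then ?g s else 0)" if "S \<in> keys \<omega>" for S
  proof (rule sum.mono_neutral_cong)
    show "finite S" using Omega_t_keysD[OF assms(1) that] by simp
    fix s
    show "((-1) ^ card {t \<in> S. t < s} * P (fst s) (snd s) * lookup \<omega> S when S - {s} = U) = 0"
      if "s \<in> S - (G - U)"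
      using assms(3)[of s] that \<open>S \<in> keys \<omega>\<close> by (auto simp: when_def insert_absorb)
    show "((-1) ^ card {t \<in> S. t < s} * P (fst s) (snd s) * lookup \<omega> S when S - {s} = U) =
        (if S = insert s U then ?g s else 0)" if "s \<in> S \<inter> (G - U)"
    proof -
      have "S - {s} = U \<longleftrightarrow> S = insert s U" using that by auto
      moreover have "{t \<in> insert s U. t < s} = {t \<in> U. t < s}" by auto
      ultimately show ?thesis by (simp add: when_def)
    qed
  qed (use assms(2) in auto)
  have "lookup (iotaO P \<omega>) U = (\<Sum>S\<in>keys \<omega>. \<Sum>s\<in>G - U. if S = insert s U then ?g s else 0)"
    unfolding iotaO_def lookup_sum lookup_single by (rule sum.cong) (simp_all add: inner)
  also have "\<dots> = (\<Sum>s\<in>G - U. \<Sum>S\<in>keys \<omega>. if S = insert s U then ?g s else 0)"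
    by (rule sum.swap)
  also have "\<dots> = (\<Sum>s\<in>G - U. ?g s)"
    by (intro sum.cong refl) (auto simp: in_keys_iff)
  finally show ?thesis .
qed

context scalars
begin

lemma cochain_coeff_iotaG:
  fixes \<gamma> :: "('i::{finite, linorder}, 'f, 'v) cochain"
  assumes "finite N"
    and N: "\<And>c \<mu>. \<mu> \<in> keys (\<gamma> (gen_u c # map (\<lambda>g. gen_u (fst g)) gs)) \<Longrightarrow> lookup \<mu> 0 \<in> N"
  shows "cochain_coeff (iotaG emb P \<gamma>) gs = (\<Sum>g\<in>UNIV \<times> N. P (fst g) (snd g) * cochain_coeff \<gamma> (g # gs))"
proof -
  \<comment> \<open>The 1/n! in P_i(x) meets the n! from the pairing of x^n with \<lambda>^n, so
    contraction simply multiplies P_{i,n} with the coefficient of \<lambda>^n.\<close>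
  have e: "emb (1 / fact n) * p * emb (fact n) = p" for n p
    using emb_mult[of "1 / fact n" "fact n"] by (simp add: emb_one ac_simps)
  let ?as = "map (\<lambda>g. gen_u (fst g)) gs" and ?ms = "map snd gs"
  have inner: "(\<Sum>\<mu>\<in>keys (\<gamma> (gen_u c # ?as)).
      P c (lookup \<mu> 0) * lookup (\<gamma> (gen_u c # ?as)) \<mu> when mon_tl \<mu> = mon_of_list ?ms) =
      (\<Sum>n\<in>N. P c n * cochain_coeff \<gamma> ((c, n) # gs))" for c
  proof -
    let ?Q = "\<gamma> (gen_u c # ?as)"
    \<comment> \<open>Each monomial is counted through the single order
      \<open>n = lookup \<mu> 0\<close>; writing this as a sum over \<open>N\<close> allows the two
      sums to be exchanged.\<close>
    have "(\<Sum>\<mu>\<in>keys ?Q. P c (lookup \<mu> 0) * lookup ?Q \<mu> when mon_tl \<mu> = mon_of_list ?ms) =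
        (\<Sum>\<mu>\<in>keys ?Q. \<Sum>n\<in>N. if \<mu> = mon_of_list (n # ?ms) then P c n * lookup ?Q \<mu> else 0)"
    proof (rule sum.cong[OF refl])
      fix \<mu> assume \<mu>: "\<mu> \<in> keys ?Q"
      have "\<mu> = mon_of_list (n # ?ms) \<longleftrightarrow> n = lookup \<mu> 0 \<and> mon_tl \<mu> = mon_of_list ?ms" for n
        unfolding mon_tl_eq_iff by (auto simp: lookup_mon_of_list)
      then have "(\<Sum>n\<in>N. if \<mu> = mon_of_list (n # ?ms) then P c n * lookup ?Q \<mu> else 0) =
          (\<Sum>n\<in>N. if n = lookup \<mu> 0 then (P c n * lookup ?Q \<mu> when mon_tl \<mu> = mon_of_list ?ms) else 0)"
        by (intro sum.cong) (auto simp: when_def)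
      then show "(P c (lookup \<mu> 0) * lookup ?Q \<mu> when mon_tl \<mu> = mon_of_list ?ms) =
          (\<Sum>n\<in>N. if \<mu> = mon_of_list (n # ?ms) then P c n * lookup ?Q \<mu> else 0)"
        using N[OF \<mu>] assms(1) by simp
    qed
    also have "\<dots> = (\<Sum>n\<in>N. \<Sum>\<mu>\<in>keys ?Q. if \<mu> = mon_of_list (n # ?ms) then P c n * lookup ?Q \<mu> else 0)"
      by (rule sum.swap)
    also have "\<dots> = (\<Sum>n\<in>N. P c n * cochain_coeff \<gamma> ((c, n) # gs))"
      by (intro sum.cong refl) (auto simp: in_keys_iff cochain_coeff_def)
    finally show ?thesis .
  qed
  have "cochain_coeff (iotaG emb P \<gamma>) gs = (\<Sum>c\<in>UNIV. \<Sum>\<mu>\<in>keys (\<gamma> (gen_u c # ?as)).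
      P c (lookup \<mu> 0) * lookup (\<gamma> (gen_u c # ?as)) \<mu> when mon_tl \<mu> = mon_of_list ?ms)"
    unfolding cochain_coeff_def iotaG_def lookup_sum lookup_single e ..
  also have "\<dots> = (\<Sum>c\<in>UNIV. \<Sum>n\<in>N. P c n * cochain_coeff \<gamma> ((c, n) # gs))"
    by (simp only: inner)
  also have "\<dots> = (\<Sum>g\<in>UNIV \<times> N. P (fst g) (snd g) * cochain_coeff \<gamma> (g # gs))"
    by (simp add: sum.cartesian_product split_def)
  finally show ?thesis .
qed

text \<open>If \<open>gs\<close> enumerates \<open>U\<close> and \<open>g\<close> is outside
  \<open>U\<close>, putting \<open>g\<close> in front costs -1 to the number of elements of
  \<open>U\<close> below \<open>g\<close>, which is the sign in \<open>iotaO\<close>.\<close>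

lemma Phi_iotaG:
  fixes \<gamma> :: "('i::{finite, linorder}, 'f, 'v) cochain"
  assumes \<gamma>: "\<gamma> \<in> Gamma_t emb (Suc k)"
  shows "Phi emb k (iotaG emb P \<gamma>) = iotaO P (Phi emb (Suc k) \<gamma>)"
proof (rule Omega_t_eqI[OF Phi_in_Omega_t iotaO_in_Omega_t[OF Phi_in_Omega_t]])
  fix U :: "('i \<times> nat) set" assume U: "finite U" "card U = k"
  let ?\<omega> = "Phi emb (Suc k) \<gamma>"
  show "lookup (Phi emb k (iotaG emb P \<gamma>)) U = lookup (iotaO P ?\<omega>) U"
  proof (rule lookup_Phi_alternating[OF U])
    fix gs assume gs: "distinct gs" "set gs = U"
    then have len: "length gs = k" using U by (metis distinct_card)
    have cochain_coeff: "cochain_coeff \<gamma> (g # gs) = of_int (list_sign (g # gs)) * lookup ?\<omega> (insert g U)" for g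
      using cochain_coeff_eq_lookup_Phi[OF \<gamma>, of "g # gs"] len gs by simp
    define N where "N = (\<Union>c. (\<lambda>\<mu>. lookup \<mu> 0) ` keys (\<gamma> (gen_u c # map (\<lambda>g. gen_u (fst g)) gs)))"
    have N: "finite N" unfolding N_def by simp
    \<comment> \<open>Multiplying by the sign once more recovers the component from the coefficient,
      so a nonzero component forces the order of \<open>s\<close> to occur as an exponent of
      \<lambda>_0.\<close>
    have G: "s \<in> UNIV \<times> N" if "s \<notin> U" "insert s U \<in> keys ?\<omega>" for s
    proof -
      have "list_sign (s # gs) * list_sign (s # gs) = 1" using that gs by (intro list_sign_mult_self) auto
      then have "of_int (list_sign (s # gs)) * cochain_coeff \<gamma> (s # gs) = lookup ?\<omega> (insert s U)"
        unfolding cochain_coeff by (metis mult.assoc mult_1 of_int_1 of_int_mult)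
      then have "cochain_coeff \<gamma> (s # gs) \<noteq> 0" using that by (auto simp: in_keys_iff)
      then have "mon_of_list (snd s # map snd gs) \<in> keys (\<gamma> (gen_u (fst s) # map (\<lambda>g. gen_u (fst g)) gs))"
        by (simp add: cochain_coeff_def in_keys_iff)
      then have "lookup (mon_of_list (snd s # map snd gs)) 0 \<in> N" unfolding N_def by blast
      then show ?thesis by (cases s) (simp add: lookup_mon_of_list)
    qed
    have "cochain_coeff (iotaG emb P \<gamma>) gs = (\<Sum>g\<in>UNIV \<times> N. P (fst g) (snd g) * cochain_coeff \<gamma> (g # gs))"
      by (rule cochain_coeff_iotaG[OF N]) (auto simp: N_def)
    also have "\<dots> = (\<Sum>g\<in>UNIV \<times> N - U. P (fst g) (snd g) * cochain_coeff \<gamma> (g # gs))"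
      by (rule sum.mono_neutral_right) (auto simp: N cochain_coeff gs)
    also have "\<dots> = (\<Sum>g\<in>UNIV \<times> N - U. of_int (list_sign gs) *
        ((-1) ^ card {t \<in> U. t < g} * P (fst g) (snd g) * lookup ?\<omega> (insert g U)))"
      by (rule sum.cong) (auto simp: cochain_coeff gs ac_simps)
    also have "\<dots> = of_int (list_sign gs) * lookup (iotaO P ?\<omega>) U"
      unfolding sum_distrib_left[symmetric] using N G
      by (subst lookup_iotaO[OF Phi_in_Omega_t, of "UNIV \<times> N"]) auto
    finally show "cochain_coeff (iotaG emb P \<gamma>) gs = of_int (list_sign gs) * lookup (iotaO P ?\<omega>) U" .
  qed
qed

end

subsection \<open>The differential\<close>

lemma lookup_act_gen:
  assumes "finite {n. pd c n f \<noteq> 0}"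
  shows "lookup (act_gen pd c j f) (single j n) = pd c n f"
    and "\<mu> \<in> keys (act_gen pd c j f) \<Longrightarrow> keys \<mu> \<subseteq> {j}"
proof -
  have eq: "act_gen pd c j f = (\<Sum>n | pd c n f \<noteq> 0. single (single j n) (pd c n f))"
    unfolding act_gen_def
    by (rule Sum_any.expand_superset[OF assms]) auto
  show "lookup (act_gen pd c j f) (single j n) = pd c n f"
    using assms by (auto simp: eq lookup_sum lookup_single when_def inj_eq[OF inj_single])
  show "keys \<mu> \<subseteq> {j}" if "\<mu> \<in> keys (act_gen pd c j f)"
    using that Poly_Mapping.keys_sum[of "\<lambda>n. single (single j n) (pd c n f)" "{n. pd c n f \<noteq> 0}"]
    unfolding eq by (fastforce split: if_splits)
qed

text \<open>The signs of lists act on V as integers, and additivity is enough to pull them through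
  \<open>d\<close> and the partial derivatives.\<close>

lemma additive_of_int_mult:
  fixes D :: "'v::comm_ring_1 \<Rightarrow> 'v"
  assumes "\<And>a b. D (a + b) = D a + D b"
  shows "D (of_int z * a) = of_int z * D a"
proof -
  have nat: "D (of_nat n * a) = of_nat n * D a" for n
    by (induction n) (simp_all add: distrib_right assms additive_zero[of D, OF assms])
  have "D (- b) + D b = 0" for b using assms[of "- b" b] additive_zero[of D, OF assms] by simp
  then have "D (- b) = - D b" for b by (simp add: eq_neg_iff_add_eq_0)
  then show ?thesis using nat by (cases z rule: int_cases2) simp_all
qed

lemma power_minus_one_lconst: "(-1) ^ i = lconst ((-1) ^ i :: 'v::comm_ring_1)"
  by (induction i) (simp_all add: lconst_def mult_single single_uminus)

text \<open>The order-preserving map that leaves out \<open>i\<close>: after renaming along it,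
  \<lambda>_i stays free for the acting element.\<close>

lemma skip_image: "i \<le> k \<Longrightarrow> (\<lambda>j. if j < i then j else Suc j) ` {..<k} = {..<Suc k} - {i}"
proof (intro equalityI subsetI)
  fix j assume "i \<le> k" "j \<in> {..<Suc k} - {i}"
  then show "j \<in> (\<lambda>j. if j < i then j else Suc j) ` {..<k}"
    by (intro image_eqI[of _ _ "if j < i then j else j - 1"]) auto
qed auto

lemma inj_on_skip: "inj_on (\<lambda>j. if j < i then j else Suc j) A"
  by (auto simp: inj_on_def split: if_splits)

lemma map_skip:
  assumes "length xs = Suc k" "i \<le> k"
  shows "map (\<lambda>j. xs ! (if j < i then j else Suc j)) [0..<k] = take i xs @ drop (Suc i) xs"
  by (rule nth_equalityI) (use assms in \<open>auto simp: nth_append\<close>)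

lemma list_sign_move_front:
  assumes "i < length gs"
  shows "list_sign gs = (-1) ^ i * list_sign (gs ! i # take i gs @ drop (Suc i) gs)"
proof -
  have "list_sign (gs ! i # take i gs @ drop (Suc i) gs) = (-1) ^ i * list_sign (take i gs @ gs ! i # drop (Suc i) gs)"
    using assms list_sign_move[of "gs ! i" "take i gs"] by (simp add: min_def)
  moreover have "take i gs @ gs ! i # drop (Suc i) gs = gs" using assms by (rule id_take_nth_drop[symmetric])
  ultimately show ?thesis by (simp add: mult.assoc[symmetric] power_add[symmetric])
qed

locale diff_functions = scalars emb
  for emb :: "'f::field_char_0 \<Rightarrow> 'v::comm_ring_1" +
  fixes d :: "'v \<Rightarrow> 'v" and pd :: "'i::{finite, linorder} \<Rightarrow> nat \<Rightarrow> 'v \<Rightarrow> 'v"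
  assumes V: "alg_diff_fun emb d pd"
begin

lemma d_add: "d (a + b) = d a + d b"
  and d_emb: "d (emb c * a) = emb c * d a"
  and pd_add: "pd i n (a + b) = pd i n a + pd i n b"
  and pd_finite: "finite {(i, n). pd i n f \<noteq> 0}"
  using V by (auto simp: alg_diff_fun_def is_derivation_def)

lemmas d_zero = additive_zero[of d, OF d_add]
lemmas pd_zero = additive_zero[of "pd i n" for i n, OF pd_add]

lemma pd_finite_row: "finite {n. pd i n f \<noteq> 0}"
  by (rule finite_subset[OF _ finite_imageI[OF pd_finite[of f], of snd]]) force

text \<open>As \<lambda>_j does not occur in \<open>Q\<close>, its exponent comes from the action
  alone and selects the partial derivative, while the remaining exponents select the coefficient of
  \<open>Q\<close>.\<close>

lemma lookup_act_gen_u: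
  assumes Q: "\<And>\<nu>. \<nu> \<in> keys Q \<Longrightarrow> j \<notin> keys \<nu>"
  shows "lookup (act emb pd (gen_u c) j Q) \<mu> =
    pd c (lookup \<mu> j) (lookup Q (\<mu> - single j (lookup \<mu> j)))"
proof -
  let ?\<mu>' = "\<mu> - single j (lookup \<mu> j)"
  have "act emb pd (gen_u c) j Q = (\<Sum>\<nu>\<in>keys Q. \<Sum>c'\<in>UNIV.
      if c' = c then act_gen pd c j (lookup Q \<nu>) * single \<nu> 1 else 0)"
    unfolding act_def poly_neg_var_gen_u by (intro sum.cong refl) simp
  also have "\<dots> = (\<Sum>\<nu>\<in>keys Q. act_gen pd c j (lookup Q \<nu>) * single \<nu> 1)" by simp
  finally have act: "act emb pd (gen_u c) j Q = (\<Sum>\<nu>\<in>keys Q. act_gen pd c j (lookup Q \<nu>) * single \<nu> 1)" .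
  have split: "\<mu> = single j (lookup \<mu> j) + ?\<mu>'"
    by (rule poly_mapping_eqI) (auto simp: lookup_add lookup_minus lookup_single when_def)
  have "lookup (act_gen pd c j f * single \<nu> 1) \<mu> = (if \<nu> = ?\<mu>' then pd c (lookup \<mu> j) f else 0)"
    if "\<nu> \<in> keys Q" for \<nu> f
  proof -
    have "lookup (act_gen pd c j f * single \<nu> 1) (single j (lookup \<mu> j) + ?\<mu>') =
        lookup (act_gen pd c j f) (single j (lookup \<mu> j)) * lookup (single \<nu> 1) ?\<mu>'"
    proof (rule lookup_mult_disjoint[where A = "{j}" and B = "- {j}"])
      show "keys \<mu>' \<subseteq> {j}" if "\<mu>' \<in> keys (act_gen pd c j f)" for \<mu>'
        by (rule lookup_act_gen(2)[OF pd_finite_row that])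
      show "keys ?\<mu>' \<subseteq> - {j}" by (auto simp: in_keys_iff lookup_minus)
    qed (use Q[OF that] in auto)
    then show ?thesis
      unfolding split[symmetric] by (simp add: lookup_act_gen(1)[OF pd_finite_row] lookup_single when_def)
  qed
  then have "lookup (act emb pd (gen_u c) j Q) \<mu> =
      (\<Sum>\<nu>\<in>keys Q. if \<nu> = ?\<mu>' then pd c (lookup \<mu> j) (lookup Q \<nu>) else 0)"
    unfolding act lookup_sum by (intro sum.cong refl) blast
  then show ?thesis by (auto simp: in_keys_iff pd_zero)
qed

lemma cochain_coeff_deltaG:
  fixes \<gamma> :: "('i, 'f, 'v) cochain"
  assumes \<gamma>: "\<gamma> \<in> Gamma_t emb k" and len: "length gs = Suc k"
  shows "cochain_coeff (deltaG emb pd k \<gamma>) gs =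
    (\<Sum>i\<le>k. (-1) ^ i * pd (fst (gs ! i)) (snd (gs ! i)) (cochain_coeff \<gamma> (take i gs @ drop (Suc i) gs)))"
proof -
  let ?as = "map (\<lambda>g. gen_u (fst g)) gs :: ('i, 'f) amod list" and ?ms = "map snd gs"
  have "lookup ((-1) ^ i * act emb pd (?as ! i) i
      (ren (\<lambda>j. if j < i then j else Suc j) (\<gamma> (take i ?as @ drop (Suc i) ?as)))) (mon_of_list ?ms) =
      (-1) ^ i * pd (fst (gs ! i)) (snd (gs ! i)) (cochain_coeff \<gamma> (take i gs @ drop (Suc i) gs))" if i: "i \<le> k" for i
  proof -
    let ?\<rho> = "\<lambda>j. if j < i then j else Suc j" and ?Q = "\<gamma> (take i ?as @ drop (Suc i) ?as)"
    let ?\<nu> = "mon_of_list ?ms - single i (lookup (mon_of_list ?ms) i)"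
    have Q: "vars_below k ?Q" by (rule vars_below_Gamma_t[OF \<gamma>])
    note l = lookup_ren[OF inj_on_skip[of i] Q]
    have "i \<notin> keys \<nu>" if "\<nu> \<in> keys (ren ?\<rho> ?Q)" for \<nu>
      using keys_ren[OF inj_on_skip Q that] skip_image[OF i] by blast
    then have "lookup (act emb pd (gen_u (fst (gs ! i))) i (ren ?\<rho> ?Q)) (mon_of_list ?ms) =
        pd (fst (gs ! i)) (lookup (mon_of_list ?ms) i) (lookup (ren ?\<rho> ?Q) ?\<nu>)"
      by (rule lookup_act_gen_u)
    \<comment> \<open>Deleting the exponent of \<lambda>_i and pulling back along the skipping map
      leaves the exponents of \<open>gs\<close> with its entry at position \<open>i\<close>
      removed.\<close>
    moreover have "lookup (ren ?\<rho> ?Q) ?\<nu> = cochain_coeff \<gamma> (take i gs @ drop (Suc i) gs)"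
    proof -
      have "keys ?\<nu> \<subseteq> ?\<rho> ` {..<k}"
        unfolding skip_image[OF i]
        by (auto simp: in_keys_iff lookup_minus lookup_mon_of_list lookup_single when_def len split: if_splits)
      moreover have "map (\<lambda>j. lookup ?\<nu> (?\<rho> j)) [0..<k] = map (\<lambda>j. ?ms ! ?\<rho> j) [0..<k]"
        by (rule map_cong[OF refl]) (use len in \<open>auto simp: lookup_minus lookup_single lookup_mon_of_list\<close>)
      ultimately have "lookup (ren ?\<rho> ?Q) ?\<nu> = lookup ?Q (mon_of_list (map (\<lambda>j. ?ms ! ?\<rho> j) [0..<k]))"
        by (simp only: l if_True)
      also have "map (\<lambda>j. ?ms ! ?\<rho> j) [0..<k] = map snd (take i gs @ drop (Suc i) gs)"
        using map_skip[of ?ms k i] len i by (simp add: take_map drop_map)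
      finally show ?thesis by (simp add: cochain_coeff_def take_map drop_map)
    qed
    ultimately show ?thesis
      using len i unfolding power_minus_one_lconst lookup_lconst_mult by (simp add: lookup_mon_of_list)
  qed
  then show ?thesis using len unfolding cochain_coeff_def[of "deltaG emb pd k \<gamma>"] deltaG_def by (simp add: lookup_sum)
qed

lemma deltaO_eq:
  "deltaO pd \<omega> = (\<Sum>T\<in>keys \<omega>. \<Sum>g\<in>{g. pd (fst g) (snd g) (lookup \<omega> T) \<noteq> 0} - T.
     single (insert g T) ((-1) ^ card {t \<in> T. t < g} * pd (fst g) (snd g) (lookup \<omega> T)))"
proof -
  have fin: "finite {g. pd (fst g) (snd g) v \<noteq> 0}" for v using pd_finite[of v] by (simp add: split_def)
  have "wedgeO (Sum_any (\<lambda>g. single {g} (pd (fst g) (snd g) v))) (single T 1) =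
      (\<Sum>g\<in>{g. pd (fst g) (snd g) v \<noteq> 0} - T. single (insert g T) ((-1) ^ card {t \<in> T. t < g} * pd (fst g) (snd g) v))"
    for v and T :: "('i \<times> nat) set"
  proof -
    have S: "Sum_any (\<lambda>g. single {g} (pd (fst g) (snd g) v)) =
        (\<Sum>g | pd (fst g) (snd g) v \<noteq> 0. single {g} (pd (fst g) (snd g) v))"
      by (rule Sum_any.expand_superset[OF fin]) auto
    show ?thesis
      unfolding S wedgeO_sum_left wedgeO_genO_single
      by (rule sum.mono_neutral_cong) (auto simp: fin)
  qed
  then show ?thesis by (simp add: deltaO_def)
qed

lemma deltaO_in_Omega_t:
  assumes "\<omega> \<in> Omega_t k"
  shows "deltaO pd \<omega> \<in> Omega_t (Suc k)"
  unfolding deltaO_eq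
proof (intro Omega_t_sum)
  fix T g assume "T \<in> keys \<omega>" "g \<in> {g. pd (fst g) (snd g) (lookup \<omega> T) \<noteq> 0} - T"
  then show "single (insert g T) ((-1) ^ card {t \<in> T. t < g} * pd (fst g) (snd g) (lookup \<omega> T)) \<in> Omega_t (Suc k)"
    using Omega_t_keysD[OF assms] by (intro Omega_t_single) auto
qed

text \<open>Opposite to contraction: the component at \<open>S\<close> collects the components at
  \<open>S - {s}\<close>, and finiteness of \<open>S\<close> bounds the sum.\<close>

lemma lookup_deltaO:
  assumes "finite S"
  shows "lookup (deltaO pd \<omega>) S =
    (\<Sum>s\<in>S. (-1) ^ card {t \<in> S. t < s} * pd (fst s) (snd s) (lookup \<omega> (S - {s})))"
proof -
  let ?h = "\<lambda>s. (-1) ^ card {t \<in> S. t < s} * pd (fst s) (snd s) (lookup \<omega> (S - {s}))"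
  have fin: "finite {g. pd (fst g) (snd g) v \<noteq> 0}" for v using pd_finite[of v] by (simp add: split_def)
  have inner: "(\<Sum>g\<in>{g. pd (fst g) (snd g) (lookup \<omega> T) \<noteq> 0} - T.
      (-1) ^ card {t \<in> T. t < g} * pd (fst g) (snd g) (lookup \<omega> T) when insert g T = S) =
      (\<Sum>s\<in>S. if T = S - {s} then ?h s else 0)" for T
  proof (rule sum.mono_neutral_cong)
    fix g assume "g \<in> ({g. pd (fst g) (snd g) (lookup \<omega> T) \<noteq> 0} - T) \<inter> S"
    then have "insert g T = S \<longleftrightarrow> T = S - {g}" by auto
    moreover have "{t \<in> S - {g}. t < g} = {t \<in> S. t < g}" by auto
    ultimately show "((-1) ^ card {t \<in> T. t < g} * pd (fst g) (snd g) (lookup \<omega> T) when insert g T = S) =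
        (if T = S - {g} then ?h g else 0)" by (auto simp: when_def)
  qed (use assms fin in \<open>auto simp: when_def\<close>)
  have "lookup (deltaO pd \<omega>) S = (\<Sum>T\<in>keys \<omega>. \<Sum>s\<in>S. if T = S - {s} then ?h s else 0)"
    unfolding deltaO_eq lookup_sum lookup_single inner ..
  also have "\<dots> = (\<Sum>s\<in>S. \<Sum>T\<in>keys \<omega>. if T = S - {s} then ?h s else 0)"
    by (rule sum.swap)
  also have "\<dots> = (\<Sum>s\<in>S. ?h s)"
    by (intro sum.cong refl) (auto simp: in_keys_iff pd_zero)
  finally show ?thesis .
qed

text \<open>The i-th term of the cochain differential belongs to the generator
  \<open>gs ! i\<close>. Moving it to the front of \<open>gs\<close> accounts for (-1)^i, and
  sorting it in from there accounts for the sign in \<open>deltaO\<close>.\<close>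

lemma Phi_deltaG:
  fixes \<gamma> :: "('i, 'f, 'v) cochain"
  assumes \<gamma>: "\<gamma> \<in> Gamma_t emb k"
  shows "Phi emb (Suc k) (deltaG emb pd k \<gamma>) = deltaO pd (Phi emb k \<gamma>)"
proof (rule Omega_t_eqI[OF Phi_in_Omega_t deltaO_in_Omega_t[OF Phi_in_Omega_t]])
  fix S :: "('i \<times> nat) set" assume S: "finite S" "card S = Suc k"
  let ?\<omega> = "Phi emb k \<gamma>"
  let ?h = "\<lambda>s. (-1) ^ card {t \<in> S. t < s} * pd (fst s) (snd s) (lookup ?\<omega> (S - {s}))"
  show "lookup (Phi emb (Suc k) (deltaG emb pd k \<gamma>)) S = lookup (deltaO pd ?\<omega>) S"
  proof (rule lookup_Phi_alternating[OF S])
    fix gs assume gs: "distinct gs" "set gs = S"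
    then have len: "length gs = Suc k" using S by (metis distinct_card)
    have "(-1) ^ i * pd (fst (gs ! i)) (snd (gs ! i)) (cochain_coeff \<gamma> (take i gs @ drop (Suc i) gs)) =
        of_int (list_sign gs) * ?h (gs ! i)" if i: "i \<le> k" for i
    proof -
      let ?rest = "take i gs @ drop (Suc i) gs"
      have gs_eq: "gs = take i gs @ gs ! i # drop (Suc i) gs"
        using i len by (intro id_take_nth_drop) simp
      then have "distinct (take i gs @ gs ! i # drop (Suc i) gs)" using gs by metis
      moreover have "S = set (take i gs @ gs ! i # drop (Suc i) gs)" using gs gs_eq by metis
      ultimately have rest: "set ?rest = S - {gs ! i}" by auto
      then have notin: "gs ! i \<notin> set ?rest" by blast
      have "{t \<in> S - {gs ! i}. t < gs ! i} = {t \<in> S. t < gs ! i}" by auto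
      then have sign: "list_sign gs = (-1) ^ i * ((-1) ^ card {t \<in> S. t < gs ! i} * list_sign ?rest)"
        using list_sign_move_front[of i gs] i len notin unfolding list_sign.simps rest by simp
      have "(-1) ^ i * pd (fst (gs ! i)) (snd (gs ! i)) (cochain_coeff \<gamma> ?rest) =
          (-1) ^ i * (of_int (list_sign ?rest) * pd (fst (gs ! i)) (snd (gs ! i)) (lookup ?\<omega> (S - {gs ! i})))"
        using cochain_coeff_eq_lookup_Phi[OF \<gamma>, of ?rest] i len rest
        by (simp add: additive_of_int_mult[of "pd a b" for a b, OF pd_add])
      also have "\<dots> = of_int (list_sign gs) * ?h (gs ! i)"
      proof -
        \<comment> \<open>The sorting sign occurs once in \<open>list_sign gs\<close> and once in
          \<open>?h\<close>, so it cancels.\<close>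
        have e: "(-1) ^ c * ((-1) ^ c * x) = (x :: 'v)" for c x
          by (simp add: mult.assoc[symmetric] power_add[symmetric])
        have "of_int (list_sign gs) * ?h (gs ! i) = (-1) ^ i * (of_int (list_sign ?rest) *
            ((-1) ^ card {t \<in> S. t < gs ! i} * ((-1) ^ card {t \<in> S. t < gs ! i} *
              pd (fst (gs ! i)) (snd (gs ! i)) (lookup ?\<omega> (S - {gs ! i})))))"
          unfolding sign by (simp add: ac_simps)
        then show ?thesis unfolding e ..
      qed
      finally show ?thesis .
    qed
    then have "cochain_coeff (deltaG emb pd k \<gamma>) gs = (\<Sum>i\<le>k. of_int (list_sign gs) * ?h (gs ! i))"
      unfolding cochain_coeff_deltaG[OF \<gamma> len] by (intro sum.cong) auto
    also have "\<dots> = of_int (list_sign gs) * (\<Sum>i\<in>{..<Suc k}. ?h (gs ! i))"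
      by (simp add: sum_distrib_left lessThan_Suc_atMost)
    also have "(\<Sum>i\<in>{..<Suc k}. ?h (gs ! i)) = (\<Sum>s\<in>S. ?h s)"
      by (rule sum.reindex_bij_betw) (use bij_betw_nth[OF gs(1)] len gs(2) in auto)
    also have "\<dots> = lookup (deltaO pd ?\<omega>) S" by (simp only: lookup_deltaO[OF S(1)])
    finally show "cochain_coeff (deltaG emb pd k \<gamma>) gs = of_int (list_sign gs) * lookup (deltaO pd ?\<omega>) S" .
  qed
qed

end

subsection \<open>The exterior product\<close>

lemma lookup_ren_mon_notin: "keys \<mu> \<subseteq> A \<Longrightarrow> i \<notin> \<rho> ` A \<Longrightarrow> lookup (ren_mon \<rho> \<mu>) i = 0"
  using keys_ren_mon[of \<rho> \<mu>] unfolding not_in_keys_iff_lookup_eq_zero[symmetric] by blast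

lemma lookup_ren_ren_mon:
  assumes "inj_on \<rho> {..<k}" "vars_below k Q" "keys \<mu> \<subseteq> {..<k}"
  shows "lookup (ren \<rho> Q) (ren_mon \<rho> \<mu>) = lookup Q \<mu>"
proof -
  have "keys (ren_mon \<rho> \<mu>) \<subseteq> \<rho> ` {..<k}" using keys_ren_mon[of \<rho> \<mu>] assms(3) by blast
  moreover have "map (\<lambda>j. lookup (ren_mon \<rho> \<mu>) (\<rho> j)) [0..<k] = map (lookup \<mu>) [0..<k]"
    by (rule map_cong[OF refl]) (simp add: lookup_ren_mon_inj[OF assms(1,3)])
  ultimately show ?thesis
    by (simp only: lookup_ren[OF assms(1,2)] if_True mon_of_list_lookup[OF assms(3)])
qed

text \<open>\<open>p\<close> sends the first \<open>h\<close> and the last \<open>k\<close>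
  positions to complementary subsets of the positions, so every exponent falls to exactly one
  factor; variables from h + k on have exponent 0 on both sides.\<close>

lemma mon_of_list_split:
  assumes p: "p permutes {..<h + k}" and len: "length ms = h + k"
  shows "mon_of_list ms = ren_mon p (mon_of_list (map (\<lambda>j. ms ! p j) [0..<h])) +
    ren_mon (\<lambda>j. p (h + j)) (mon_of_list (map (\<lambda>j. ms ! p (h + j)) [0..<k]))"
    (is "_ = ren_mon p ?\<mu> + ren_mon ?q ?\<nu>")
proof (rule poly_mapping_eqI)
  fix i
  have inj: "inj_on p A" "inj_on ?q A" for A by (auto simp: inj_on_def dest!: injD[OF permutes_inj[OF p]])
  have \<mu>: "keys ?\<mu> \<subseteq> {..<h}" and \<nu>: "keys ?\<nu> \<subseteq> {..<k}"
    using keys_mon_of_list[of "map (\<lambda>j. ms ! p j) [0..<h]"]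
      keys_mon_of_list[of "map (\<lambda>j. ms ! p (h + j)) [0..<k]"] by simp_all
  have lt: "p j < h + k \<longleftrightarrow> j < h + k" for j using permutes_in_image[OF p, of j] by simp
  have inj': "p a = p b \<longleftrightarrow> a = b" for a b using permutes_inj[OF p] by (auto dest: injD)
  obtain j where j: "i = p j" using permutes_surj[OF p] by blast
  consider "j < h" | j' where "j = h + j'" "j' < k" | "j \<ge> h + k"
    by (metis le_add_diff_inverse linorder_not_le nat_add_left_cancel_less)
  then have "lookup (mon_of_list ms) i = lookup (ren_mon p ?\<mu>) i + lookup (ren_mon ?q ?\<nu>) i"
  proof cases
    case 1
    then have "lookup (ren_mon ?q ?\<nu>) i = 0"
      by (intro lookup_ren_mon_notin[OF \<nu>]) (auto simp: j inj')
    moreover have "lookup (ren_mon p ?\<mu>) i = ms ! i"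
      using 1 lookup_ren_mon_inj[OF inj(1) \<mu>, of j] by (simp add: j lookup_mon_of_list)
    ultimately show ?thesis using 1 len lt[of j] by (simp add: j lookup_mon_of_list)
  next
    case 2
    then have "lookup (ren_mon p ?\<mu>) i = 0"
      by (intro lookup_ren_mon_notin[OF \<mu>]) (auto simp: j inj')
    moreover have "lookup (ren_mon ?q ?\<nu>) i = ms ! i"
      using 2 lookup_ren_mon_inj[OF inj(2) \<nu>, of j'] by (simp add: j lookup_mon_of_list)
    ultimately show ?thesis using 2 len lt[of j] by (simp add: j lookup_mon_of_list)
  next
    case 3
    then have "lookup (ren_mon p ?\<mu>) i = 0" "lookup (ren_mon ?q ?\<nu>) i = 0"
      by (intro lookup_ren_mon_notin[OF \<mu>] lookup_ren_mon_notin[OF \<nu>]; auto simp: j inj')+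
    then show ?thesis using 3 len lt[of j] by (simp add: j lookup_mon_of_list)
  qed
  then show "lookup (mon_of_list ms) i = lookup (ren_mon p ?\<mu> + ren_mon ?q ?\<nu>) i"
    by (simp add: lookup_add)
qed

lemma map_take_permute_list:
  assumes "p permutes {..<h + k}" "length xs = h + k"
  shows "map f (take h (permute_list p xs)) = map (\<lambda>j. map f xs ! p j) [0..<h]"
    and "map f (drop h (permute_list p xs)) = map (\<lambda>j. map f xs ! p (h + j)) [0..<k]"
proof -
  have "p j < h + k" if "j < h + k" for j using permutes_in_image[OF assms(1), of j] that by simp
  then show "map f (take h (permute_list p xs)) = map (\<lambda>j. map f xs ! p j) [0..<h]"
    and "map f (drop h (permute_list p xs)) = map (\<lambda>j. map f xs ! p (h + j)) [0..<k]"
    using assms(2) by (auto simp: permute_list_def list_eq_iff_nth_eq)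
qed

lemma wedge_list_permute:
  assumes "p permutes {..<length gs}"
  shows "wedge_list (permute_list p gs) = scO (of_int (sign p)) (wedge_list gs)"
  using assms by (simp add: wedge_list_eq scO_single list_sign_permute)

lemma wedgeO_scO_left: "wedgeO (scO f \<omega>) \<eta> = scO f (wedgeO \<omega> \<eta>)"
proof (induction \<omega> rule: poly_mapping_additive_induct)
  case (single S a)
  show ?case
    by (induction \<eta> rule: poly_mapping_additive_induct)
      (simp_all add: scO_single wedgeO_single wedgeO_add_right scO_add ac_simps)
qed (simp add: scO_add wedgeO_add_left)

lemma wedgeO_scO_right: "wedgeO \<omega> (scO f \<eta>) = scO f (wedgeO \<omega> \<eta>)"
proof (induction \<omega> rule: poly_mapping_additive_induct)
  case (single S a)
  show ?case
    by (induction \<eta> rule: poly_mapping_additive_induct)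
      (simp_all add: scO_single wedgeO_single wedgeO_add_right scO_add ac_simps)
qed (simp add: scO_add wedgeO_add_left)

lemma bij_permute_list_lists:
  assumes p: "p permutes {..<k}"
  shows "bij_betw (permute_list p) {gs. set gs \<subseteq> G \<and> length gs = k} {gs. set gs \<subseteq> G \<and> length gs = k}"
proof (rule bij_betw_byWitness[where f' = "permute_list (inv p)"])
  have q: "inv p permutes {..<k}" by (rule permutes_inv[OF p])
  show "\<forall>gs\<in>{gs. set gs \<subseteq> G \<and> length gs = k}. permute_list (inv p) (permute_list p gs) = gs"
    using q p by (auto simp: permute_list_compose[symmetric] permutes_inv_o)
  show "\<forall>gs\<in>{gs. set gs \<subseteq> G \<and> length gs = k}. permute_list p (permute_list (inv p) gs) = gs"
    using q p by (auto simp: permute_list_compose[symmetric] permutes_inv_o)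
qed (use p permutes_inv[OF p] in auto)

lemma finite_lists_in: "finite G \<Longrightarrow> finite {gs. set gs \<subseteq> G \<and> length gs = k}"
  by (rule finite_lists_length_eq)

lemma cochain_coeff_support:
  fixes \<gamma> :: "('i::finite, 'f::field_char_0, 'v::comm_ring_1) cochain"
  shows "\<exists>G. finite G \<and> (\<forall>gs. length gs = k \<and> cochain_coeff \<gamma> gs \<noteq> 0 \<longrightarrow> set gs \<subseteq> G)"
  using finite_cochain_coeff[of k \<gamma>] by (intro exI[of _ "\<Union>(set ` {gs. length gs = k \<and> cochain_coeff \<gamma> gs \<noteq> 0})"]) auto

context scalars
begin

lemma Phi_eq_lists:
  fixes \<gamma> :: "('i::{finite, linorder}, 'f, 'v) cochain"
  assumes "finite G" "\<And>gs. length gs = k \<Longrightarrow> cochain_coeff \<gamma> gs \<noteq> 0 \<Longrightarrow> set gs \<subseteq> G"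
  shows "Phi emb k \<gamma> = scO (emb (1 / fact k))
    (\<Sum>gs | set gs \<subseteq> G \<and> length gs = k. scO (cochain_coeff \<gamma> gs) (wedge_list gs))"
  by (rule Phi_eq_sum) (use assms finite_lists_in in auto)

text \<open>After renaming, the factors live in the variables indexed by the images under
  \<open>p\<close> of the first \<open>h\<close> and the last \<open>k\<close> positions. These are
  disjoint, so each \<open>p\<close> contributes a single product of coefficients.\<close>

lemma cochain_coeff_wedgeG:
  fixes \<alpha> \<beta> :: "('i::{finite, linorder}, 'f, 'v) cochain"
  assumes \<alpha>: "\<alpha> \<in> Gamma_t emb h" and \<beta>: "\<beta> \<in> Gamma_t emb k" and len: "length gs = h + k"
  shows "cochain_coeff (wedgeG emb h k \<alpha> \<beta>) gs = (\<Sum>p | p permutes {..<h + k}.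
    of_int (sign p) * emb (1 / (fact h * fact k)) *
      (cochain_coeff \<alpha> (take h (permute_list p gs)) * cochain_coeff \<beta> (drop h (permute_list p gs))))"
proof -
  let ?as = "map (\<lambda>g. gen_u (fst g)) gs :: ('i, 'f) amod list" and ?ms = "map snd gs"
  have "lookup (lconst (of_int (sign p) * emb (1 / (fact h * fact k))) *
      ren (\<lambda>j. p j) (\<alpha> (map (\<lambda>j. ?as ! p j) [0..<h])) *
      ren (\<lambda>j. p (h + j)) (\<beta> (map (\<lambda>j. ?as ! p (h + j)) [0..<k]))) (mon_of_list ?ms) =
    of_int (sign p) * emb (1 / (fact h * fact k)) *
      (cochain_coeff \<alpha> (take h (permute_list p gs)) * cochain_coeff \<beta> (drop h (permute_list p gs)))"
    if p: "p permutes {..<h + k}" for p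
  proof -
    let ?q = "\<lambda>j. p (h + j)"
    let ?P = "\<alpha> (map (\<lambda>j. ?as ! p j) [0..<h])" and ?Q = "\<beta> (map (\<lambda>j. ?as ! ?q j) [0..<k])"
    let ?\<mu> = "mon_of_list (map (\<lambda>j. ?ms ! p j) [0..<h])" and ?\<nu> = "mon_of_list (map (\<lambda>j. ?ms ! ?q j) [0..<k])"
    have inj: "inj_on p A" "inj_on ?q A" for A by (auto simp: inj_on_def dest!: injD[OF permutes_inj[OF p]])
    have \<mu>: "keys ?\<mu> \<subseteq> {..<h}" and \<nu>: "keys ?\<nu> \<subseteq> {..<k}"
      using keys_mon_of_list[of "map (\<lambda>j. ?ms ! p j) [0..<h]"]
        keys_mon_of_list[of "map (\<lambda>j. ?ms ! ?q j) [0..<k]"] by simp_all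
    have P: "vars_below h ?P" and Q: "vars_below k ?Q"
      using \<alpha> \<beta> by (auto intro: vars_below_Gamma_t)
    have disj: "p ` {..<h} \<inter> ?q ` {..<k} = {}"
      using permutes_inj[OF p] by (auto dest: injD)
    have "keys (ren_mon p ?\<mu>) \<subseteq> p ` {..<h}" "keys (ren_mon ?q ?\<nu>) \<subseteq> ?q ` {..<k}"
      using keys_ren_mon[of p ?\<mu>] keys_ren_mon[of ?q ?\<nu>] \<mu> \<nu> by blast+
    with keys_ren[OF inj(1) P] keys_ren[OF inj(2) Q] disj
    have "lookup (ren p ?P * ren ?q ?Q) (ren_mon p ?\<mu> + ren_mon ?q ?\<nu>) =
        lookup (ren p ?P) (ren_mon p ?\<mu>) * lookup (ren ?q ?Q) (ren_mon ?q ?\<nu>)"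
      by (rule lookup_mult_disjoint)
    also have "\<dots> = lookup ?P ?\<mu> * lookup ?Q ?\<nu>"
      by (simp only: lookup_ren_ren_mon[OF inj(1) P \<mu>] lookup_ren_ren_mon[OF inj(2) Q \<nu>])
    also have "ren_mon p ?\<mu> + ren_mon ?q ?\<nu> = mon_of_list ?ms"
      using len by (intro mon_of_list_split[OF p, symmetric]) simp
    also have "lookup ?P ?\<mu> = cochain_coeff \<alpha> (take h (permute_list p gs))"
      by (simp only: cochain_coeff_def map_take_permute_list[OF p len])
    also have "lookup ?Q ?\<nu> = cochain_coeff \<beta> (drop h (permute_list p gs))"
      by (simp only: cochain_coeff_def map_take_permute_list[OF p len])
    finally show ?thesis by (simp only: mult.assoc lookup_lconst_mult)
  qed
  then show ?thesis
    unfolding cochain_coeff_def[of "wedgeG emb h k \<alpha> \<beta>"] wedgeG_def length_map len if_P[OF refl] lookup_sum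
    by (intro sum.cong refl) simp
qed

lemma Phi_wedgeG:
  fixes \<alpha> \<beta> :: "('i::{finite, linorder}, 'f, 'v) cochain"
  assumes \<alpha>: "\<alpha> \<in> Gamma_t emb h" and \<beta>: "\<beta> \<in> Gamma_t emb k"
  shows "Phi emb (h + k) (wedgeG emb h k \<alpha> \<beta>) = wedgeO (Phi emb h \<alpha>) (Phi emb k \<beta>)"
proof -
  obtain G1 where G1: "finite G1" "\<And>gs. length gs = h \<Longrightarrow> cochain_coeff \<alpha> gs \<noteq> 0 \<Longrightarrow> set gs \<subseteq> G1"
    using cochain_coeff_support[of h \<alpha>] by blast
  obtain G2 where G2: "finite G2" "\<And>gs. length gs = k \<Longrightarrow> cochain_coeff \<beta> gs \<noteq> 0 \<Longrightarrow> set gs \<subseteq> G2"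
    using cochain_coeff_support[of k \<beta>] by blast
  define G where "G = G1 \<union> G2"
  have G: "finite G" using G1 G2 by (simp add: G_def)
  define L where "L n = {gs. set gs \<subseteq> G \<and> length gs = n}" for n
  \<comment> \<open>The sign of \<open>p\<close> will be absorbed into \<open>wedge_list\<close>:
    the term of \<open>p\<close> at \<open>gs\<close> becomes one fixed function \<open>X\<close>,
    evaluated at the permuted list.\<close>
  define X where "X gs = scO (emb (1 / (fact h * fact k)) * (cochain_coeff \<alpha> (take h gs) * cochain_coeff \<beta> (drop h gs))) (wedge_list gs)" for gs
  have X: "scO (cochain_coeff (wedgeG emb h k \<alpha> \<beta>) gs) (wedge_list gs) = (\<Sum>p | p permutes {..<h + k}. X (permute_list p gs))"
    if "gs \<in> L (h + k)" for gs
  proof -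
    have len: "length gs = h + k" using that by (simp add: L_def)
    have "X (permute_list p gs) = scO (of_int (sign p) * emb (1 / (fact h * fact k)) *
        (cochain_coeff \<alpha> (take h (permute_list p gs)) * cochain_coeff \<beta> (drop h (permute_list p gs)))) (wedge_list gs)"
      if "p permutes {..<h + k}" for p
      using that len unfolding X_def by (subst wedge_list_permute) (simp_all add: scO_scO ac_simps)
    then show ?thesis
      unfolding cochain_coeff_wedgeG[OF \<alpha> \<beta> len] by (simp add: additive_sum[of "\<lambda>f. scO f (wedge_list gs)", OF scO_add_left])
  qed
  have "Phi emb (h + k) (wedgeG emb h k \<alpha> \<beta>) = scO (emb (1 / fact (h + k)))
      (\<Sum>gs\<in>L (h + k). scO (cochain_coeff (wedgeG emb h k \<alpha> \<beta>) gs) (wedge_list gs))"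
    unfolding L_def
  proof (rule Phi_eq_lists[OF G])
    fix gs assume len: "length gs = h + k" and nz: "cochain_coeff (wedgeG emb h k \<alpha> \<beta>) gs \<noteq> 0"
    \<comment> \<open>Some \<open>p\<close> must give two nonzero factors; as \<open>p\<close> only
      reorders \<open>gs\<close>, each entry lies in one of the two supports.\<close>
    from nz[unfolded cochain_coeff_wedgeG[OF \<alpha> \<beta> len]] obtain p where p: "p permutes {..<h + k}"
      and "of_int (sign p) * emb (1 / (fact h * fact k)) *
        (cochain_coeff \<alpha> (take h (permute_list p gs)) * cochain_coeff \<beta> (drop h (permute_list p gs))) \<noteq> 0"
      by (metis (mono_tags, lifting) mem_Collect_eq sum.not_neutral_contains_not_neutral)
    then have nz': "cochain_coeff \<alpha> (take h (permute_list p gs)) \<noteq> 0" "cochain_coeff \<beta> (drop h (permute_list p gs)) \<noteq> 0" by auto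
    have "set gs = set (permute_list p gs)" using p len by simp
    also have "\<dots> = set (take h (permute_list p gs)) \<union> set (drop h (permute_list p gs))"
      by (metis append_take_drop_id set_append)
    also have "\<dots> \<subseteq> G" unfolding G_def
      using G1(2)[OF _ nz'(1)] G2(2)[OF _ nz'(2)] len by auto
    finally show "set gs \<subseteq> G" .
  qed
  txt \<open>Relabelling the lists \<open>gs\<close> by \<open>p\<close> makes the summands of the product independent of \<open>p\<close>,
    so the sum over \<open>p\<close> cancels the factor \<open>1 / (h + k)!\<close>.\<close>
  also have "(\<Sum>gs\<in>L (h + k). scO (cochain_coeff (wedgeG emb h k \<alpha> \<beta>) gs) (wedge_list gs)) =
      (\<Sum>p | p permutes {..<h + k}. \<Sum>gs\<in>L (h + k). X (permute_list p gs))"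
    by (subst sum.swap) (intro sum.cong refl X)
  also have "\<dots> = (\<Sum>p | p permutes {..<h + k}. \<Sum>gs\<in>L (h + k). X gs)"
    unfolding L_def by (intro sum.cong refl sum.reindex_bij_betw bij_permute_list_lists) simp
  also have "scO (emb (1 / fact (h + k))) \<dots> = (\<Sum>gs\<in>L (h + k). X gs)"
  proof (rule poly_mapping_eqI)
    fix S
    have "card {p. p permutes {..<h + k}} = fact (h + k)" by (simp add: card_permutations)
    then have "lookup (scO (emb (1 / fact (h + k))) (\<Sum>p | p permutes {..<h + k}. \<Sum>gs\<in>L (h + k). X gs)) S =
        emb (1 / fact (h + k)) * of_nat (fact (h + k)) * lookup (\<Sum>gs\<in>L (h + k). X gs) S"
      by (simp only: lookup_scO lookup_sum[where X = "{p. p permutes {..<h + k}}"] sum_constant mult.assoc)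
    then show "lookup (scO (emb (1 / fact (h + k))) (\<Sum>p | p permutes {..<h + k}. \<Sum>gs\<in>L (h + k). X gs)) S =
        lookup (\<Sum>gs\<in>L (h + k). X gs) S"
      by (simp only: emb_inverse_fact mult_1)
  qed
  \<comment> \<open>Cutting after \<open>h\<close> entries identifies lists of length h + k with
    pairs of lists.\<close>
  also have "\<dots> = (\<Sum>(xs, ys)\<in>L h \<times> L k. X (xs @ ys))"
    by (rule sum.reindex_bij_witness[of _ "\<lambda>(xs, ys). xs @ ys" "\<lambda>gs. (take h gs, drop h gs)"])
      (auto simp: L_def dest: in_set_takeD in_set_dropD)
  also have "\<dots> = (\<Sum>xs\<in>L h. \<Sum>ys\<in>L k. X (xs @ ys))"
    by (simp add: sum.cartesian_product)
  also have "\<dots> = (\<Sum>xs\<in>L h. \<Sum>ys\<in>L k. scO (emb (1 / fact h)) (scO (emb (1 / fact k))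
      (wedgeO (scO (cochain_coeff \<alpha> xs) (wedge_list xs)) (scO (cochain_coeff \<beta> ys) (wedge_list ys)))))"
  proof (intro sum.cong refl)
    fix xs ys assume "xs \<in> L h" "ys \<in> L k"
    moreover have "emb (1 / (fact h * fact k)) = emb (1 / fact h) * emb (1 / fact k)"
      using emb_mult[of "1 / fact h" "1 / fact k"] by simp
    ultimately show "X (xs @ ys) = scO (emb (1 / fact h)) (scO (emb (1 / fact k))
      (wedgeO (scO (cochain_coeff \<alpha> xs) (wedge_list xs)) (scO (cochain_coeff \<beta> ys) (wedge_list ys))))"
      by (simp add: X_def L_def wedgeO_scO_left wedgeO_scO_right scO_scO wedge_list_append ac_simps)
  qed
  also have "\<dots> = wedgeO (scO (emb (1 / fact h)) (\<Sum>xs\<in>L h. scO (cochain_coeff \<alpha> xs) (wedge_list xs)))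
      (scO (emb (1 / fact k)) (\<Sum>ys\<in>L k. scO (cochain_coeff \<beta> ys) (wedge_list ys)))"
    by (subst sum.swap)
      (simp only: wedgeO_scO_left wedgeO_scO_right wedgeO_sum_left wedgeO_sum_right scO_sum scO_scO ac_simps)
  also have "\<dots> = wedgeO (Phi emb h \<alpha>) (Phi emb k \<beta>)"
    unfolding L_def using G1(2) G2(2)
    by (subst (1 2) Phi_eq_lists[OF G]) (auto simp: G_def)
  finally show ?thesis .
qed

end

subsection \<open>The total derivative\<close>

lemma dO_add:
  assumes "\<And>a b. d (a + b) = d a + d b"
  shows "dO d (\<omega> + \<eta>) = dO d \<omega> + dO d \<eta>"
  unfolding dO_def
  by (rule sum_keys_add) (simp_all add: assms additive_zero[of d, OF assms] scO_add_left single_add)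

lemma dO_single:
  assumes "d 0 = 0"
  shows "dO d (single S a) = single S (d a) + scO a (\<Sum>j<card S. wedge_list ((sorted_list_of_set S)
    [j := (fst (sorted_list_of_set S ! j), Suc (snd (sorted_list_of_set S ! j)))]))"
  unfolding dO_def by (rule sum_keys_single) (simp add: assms)

text \<open>The part of \<partial> that raises one order, for generators in any order, whereas
  \<open>dO\<close> is defined through increasing lists.\<close>

definition shift_sum :: "('i::linorder \<times> nat) list \<Rightarrow> ('i, 'v::comm_ring_1) form" where
  "shift_sum gs = (\<Sum>j<length gs. wedge_list (gs[j := (fst (gs ! j), Suc (snd (gs ! j)))]))"

lemma shift_sum_permute:
  fixes gs :: "('i::linorder \<times> nat) list"
  assumes p: "p permutes {..<length gs}"
  shows "shift_sum (permute_list p gs) = scO (of_int (sign p)) (shift_sum gs :: ('i, 'v::comm_ring_1) form)"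
proof -
  let ?up = "\<lambda>gs j. gs[j := (fst (gs ! j), Suc (snd (gs ! j)))]"
  have "wedge_list (?up (permute_list p gs) j) =
      scO (of_int (sign p)) (wedge_list (?up gs (p j)) :: ('i, 'v) form)"
    if "j < length gs" for j
  proof -
    have "p j < length gs" using permutes_in_image[OF p, of j] that by simp
    moreover have "p a = p b \<longleftrightarrow> a = b" for a b using permutes_inj[OF p] by (auto dest: injD)
    ultimately have "?up (permute_list p gs) j = permute_list p (?up gs (p j))"
      using that permutes_in_image[OF p]
      by (intro nth_equalityI) (auto simp: permute_list_def nth_list_update)
    then show ?thesis using p by (simp add: wedge_list_permute)
  qed
  then have "shift_sum (permute_list p gs) =
      scO (of_int (sign p)) (\<Sum>j<length gs. wedge_list (?up gs (p j)) :: ('i, 'v) form)"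
    by (simp add: shift_sum_def scO_sum)
  also have "(\<Sum>j<length gs. wedge_list (?up gs (p j)) :: ('i, 'v) form) = shift_sum gs"
    unfolding shift_sum_def by (rule sum.reindex_bij_betw[OF permutes_imp_bij[OF p]])
  finally show ?thesis .
qed

context diff_functions
begin

text \<open>Both sides alternate in \<open>gs\<close>, and on increasing lists the identity is the
  definition of \<open>dO\<close>. If a generator repeats, \<open>wedge_list gs\<close> is 0, and by
  alternation so is \<open>shift_sum gs\<close>.\<close>

lemma dO_wedge_list:
  "dO d (scO a (wedge_list gs)) = scO (d a) (wedge_list gs) + scO a (shift_sum gs :: ('i, 'v) form)"
proof -
  let ?s = "sorted_list_of_set (set gs)"
  have alt: "shift_sum gs = scO (of_int (list_sign gs)) (shift_sum ?s :: ('i, 'v) form)"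
  proof (rule poly_mapping_eqI)
    fix S
    have "lookup (shift_sum gs) S = of_int (list_sign gs) * (lookup (shift_sum ?s) S :: 'v)"
      by (rule alternating_eq[OF torsion_free, of "length gs" "\<lambda>gs. lookup (shift_sum gs) S"])
        (simp_all add: shift_sum_permute lookup_scO)
    then show "lookup (shift_sum gs) S = lookup (scO (of_int (list_sign gs)) (shift_sum ?s :: ('i, 'v) form)) S"
      by (simp add: lookup_scO)
  qed
  have "dO d (scO a (wedge_list gs)) = dO d (single (set gs) (of_int (list_sign gs) * a))"
    by (simp add: wedge_list_eq scO_single mult.commute)
  also have "\<dots> = single (set gs) (of_int (list_sign gs) * d a) + scO (of_int (list_sign gs) * a) (shift_sum ?s)"
    by (simp add: dO_single d_zero additive_of_int_mult[of d, OF d_add] shift_sum_def)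
  also have "\<dots> = scO (d a) (wedge_list gs) + scO a (shift_sum gs)"
    unfolding alt by (simp add: wedge_list_eq scO_single scO_scO mult.commute)
  finally show ?thesis .
qed

lemma dO_scO_emb: "dO d (scO (emb c) \<omega>) = scO (emb c) (dO d (\<omega> :: ('i, 'v) form))"
proof (induction \<omega> rule: poly_mapping_additive_induct)
  case (single S a)
  show ?case by (simp add: scO_single dO_single d_zero d_emb scO_add scO_scO)
qed (simp add: scO_add dO_add d_add)

lemma cochain_coeff_dG:
  fixes \<gamma> :: "('i, 'f, 'v) cochain"
  assumes "length gs = k"
  shows "cochain_coeff (dG d k \<gamma>) gs = d (cochain_coeff \<gamma> gs) + (\<Sum>j<k. if snd (gs ! j) > 0
    then cochain_coeff \<gamma> (gs[j := (fst (gs ! j), snd (gs ! j) - 1)]) else 0)"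
proof -
  let ?as = "map (\<lambda>g. gen_u (fst g)) gs :: ('i, 'f) amod list" and ?ms = "map snd gs"
  have "lookup (lvar j * \<gamma> ?as) (mon_of_list ?ms) =
      (if snd (gs ! j) > 0 then cochain_coeff \<gamma> (gs[j := (fst (gs ! j), snd (gs ! j) - 1)]) else 0)" if "j < k" for j
  proof -
    have "mon_of_list ?ms - single j 1 = mon_of_list (?ms[j := snd (gs ! j) - 1])"
      by (rule poly_mapping_eqI) (use that assms in
        \<open>auto simp: lookup_minus lookup_single lookup_mon_of_list when_def nth_list_update\<close>)
    moreover have "map (\<lambda>g. gen_u (fst g)) (gs[j := (fst (gs ! j), snd (gs ! j) - 1)]) = ?as"
      by (rule nth_equalityI) (use that assms in \<open>auto simp: nth_list_update\<close>)
    ultimately show ?thesis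
      using that assms unfolding lookup_lvar_mult by (simp add: cochain_coeff_def map_update lookup_mon_of_list)
  qed
  then show ?thesis
    unfolding cochain_coeff_def[of "dG d k \<gamma>"] dG_def
    by (simp add: lookup_add lookup_coeffwise d_zero cochain_coeff_def[symmetric] sum_distrib_right lookup_sum)
qed

text \<open>Multiplication by \<lambda>_j on the cochain side and raising the j-th generator on the
  form side are matched by shifting the j-th order in the index of summation, one slot at a
  time.\<close>

lemma Phi_dG:
  fixes \<gamma> :: "('i, 'f, 'v) cochain"
  shows "Phi emb k (dG d k \<gamma>) = dO d (Phi emb k \<gamma>)"
proof -
  obtain G where G: "finite G" "\<And>gs. length gs = k \<Longrightarrow> cochain_coeff \<gamma> gs \<noteq> 0 \<Longrightarrow> set gs \<subseteq> G"
    using cochain_coeff_support[of k \<gamma>] by blast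
  \<comment> \<open>Orders in the support stay strictly below \<open>N\<close>, so raising one of
    them by 1 keeps the list inside the box of orders at most \<open>N\<close>.\<close>
  define N where "N = Suc (Max (insert 0 (snd ` G)))"
  have "snd g < N" if "g \<in> G" for g
    unfolding N_def using that G(1) by (simp add: less_Suc_eq_le)
  then have supp: "snd g < N" if "length gs = k" "cochain_coeff \<gamma> gs \<noteq> 0" "g \<in> set gs" for g gs
    using G(2) that by blast
  let ?G = "UNIV \<times> {..N} :: ('i \<times> nat) set"
  have fin: "finite ?G" by simp
  define L where "L = {gs. set gs \<subseteq> ?G \<and> length gs = k}"
  let ?up = "\<lambda>gs j. gs[j := (fst (gs ! j), Suc (snd (gs ! j)))]"
  let ?dn = "\<lambda>gs j. gs[j := (fst (gs ! j), snd (gs ! j) - 1)]"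
  have L_iff: "gs \<in> L \<longleftrightarrow> length gs = k \<and> (\<forall>i<k. snd (gs ! i) \<le> N)" for gs
  proof -
    have "set gs \<subseteq> ?G \<longleftrightarrow> (\<forall>g\<in>set gs. snd g \<le> N)" by auto
    then show ?thesis unfolding L_def all_set_conv_all_nth by auto
  qed
  have suppi: "snd (gs ! i) < N" if "length gs = k" "cochain_coeff \<gamma> gs \<noteq> 0" "i < k" for i gs
    using supp[OF that(1,2)] that by simp
  have shift: "(\<Sum>gs\<in>L. if snd (gs ! j) > 0 then scO (cochain_coeff \<gamma> (?dn gs j)) (wedge_list gs) else 0) =
      (\<Sum>gs\<in>L. scO (cochain_coeff \<gamma> gs) (wedge_list (?up gs j)))" if j: "j < k" for j
  proof -
    have finL: "finite L" unfolding L_def by (rule finite_lists_in[OF fin])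
    have "(\<Sum>gs\<in>L. if snd (gs ! j) > 0 then scO (cochain_coeff \<gamma> (?dn gs j)) (wedge_list gs) else 0) =
        (\<Sum>gs\<in>{gs \<in> L. snd (gs ! j) > 0}. scO (cochain_coeff \<gamma> (?dn gs j)) (wedge_list gs))"
      by (rule sum.inter_filter[OF finL, symmetric])
    \<comment> \<open>Lowering slot \<open>j\<close> maps positive orders up to \<open>N\<close>
      onto orders below \<open>N\<close>. The lists with order \<open>N\<close> in that slot, added
      back afterwards, have coefficient 0.\<close>
    also have "\<dots> = (\<Sum>gs\<in>{gs \<in> L. snd (gs ! j) < N}. scO (cochain_coeff \<gamma> gs) (wedge_list (?up gs j)))"
    proof (rule sum.reindex_bij_witness[of _ "\<lambda>gs. ?up gs j" "\<lambda>gs. ?dn gs j"])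
      fix gs assume gs: "gs \<in> {gs \<in> L. snd (gs ! j) > 0}"
      show "?up (?dn gs j) j = gs"
        by (rule nth_equalityI) (use gs j in \<open>auto simp: L_iff nth_list_update\<close>)
      show "?dn gs j \<in> {gs \<in> L. snd (gs ! j) < N}"
        using gs j by (fastforce simp: L_iff nth_list_update)
      show "scO (cochain_coeff \<gamma> (?dn gs j)) (wedge_list (?up (?dn gs j) j)) = scO (cochain_coeff \<gamma> (?dn gs j)) (wedge_list gs)"
        using \<open>?up (?dn gs j) j = gs\<close> by simp
    next
      fix gs assume gs: "gs \<in> {gs \<in> L. snd (gs ! j) < N}"
      show "?dn (?up gs j) j = gs"
        by (rule nth_equalityI) (use gs j in \<open>auto simp: L_iff nth_list_update\<close>)
      show "?up gs j \<in> {gs \<in> L. snd (gs ! j) > 0}"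
        using gs j by (auto simp: L_iff nth_list_update)
    qed
    also have "\<dots> = (\<Sum>gs\<in>L. scO (cochain_coeff \<gamma> gs) (wedge_list (?up gs j)))"
    proof (rule sum.mono_neutral_left[OF finL])
      show "\<forall>gs\<in>L - {gs \<in> L. snd (gs ! j) < N}. scO (cochain_coeff \<gamma> gs) (wedge_list (?up gs j)) = 0"
      proof
        fix gs assume "gs \<in> L - {gs \<in> L. snd (gs ! j) < N}"
        then have "cochain_coeff \<gamma> gs = 0" using suppi[of gs j] j by (auto simp: L_iff)
        then show "scO (cochain_coeff \<gamma> gs) (wedge_list (?up gs j)) = 0" by simp
      qed
    qed auto
    finally show ?thesis .
  qed
  have "Phi emb k (dG d k \<gamma>) = scO (emb (1 / fact k)) (\<Sum>gs\<in>L. scO (cochain_coeff (dG d k \<gamma>) gs) (wedge_list gs))"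
    unfolding L_def
  proof (rule Phi_eq_lists[OF fin])
    fix gs assume len: "length gs = k" and nz: "cochain_coeff (dG d k \<gamma>) gs \<noteq> 0"
    have "gs \<in> L"
    proof (cases "cochain_coeff \<gamma> gs = 0")
      case True
      then obtain j where j: "j < k" "cochain_coeff \<gamma> (?dn gs j) \<noteq> 0"
        using nz unfolding cochain_coeff_dG[OF len]
        by (auto simp: d_zero elim!: sum.not_neutral_contains_not_neutral split: if_splits)
      have "snd (?dn gs j ! i) < N" if "i < k" for i
        using suppi[OF _ j(2) that] len by simp
      then have "snd (gs ! i) \<le> N" if "i < k" for i
        using that len j(1) by (cases "i = j") (fastforce simp: nth_list_update)+
      then show ?thesis using len by (simp add: L_iff)
    next
      case False
      then show ?thesis using suppi[of gs] len by (auto simp: L_iff less_imp_le)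
    qed
    then show "set gs \<subseteq> ?G" by (simp add: L_def)
  qed
  also have "(\<Sum>gs\<in>L. scO (cochain_coeff (dG d k \<gamma>) gs) (wedge_list gs)) =
      (\<Sum>gs\<in>L. scO (d (cochain_coeff \<gamma> gs)) (wedge_list gs) +
        (\<Sum>j<k. if snd (gs ! j) > 0 then scO (cochain_coeff \<gamma> (?dn gs j)) (wedge_list gs) else 0))"
  proof (rule sum.cong[OF refl])
    fix gs assume "gs \<in> L"
    then have len: "length gs = k" by (simp add: L_def)
    show "scO (cochain_coeff (dG d k \<gamma>) gs) (wedge_list gs) = scO (d (cochain_coeff \<gamma> gs)) (wedge_list gs) +
        (\<Sum>j<k. if snd (gs ! j) > 0 then scO (cochain_coeff \<gamma> (?dn gs j)) (wedge_list gs) else 0)"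
      unfolding cochain_coeff_dG[OF len] scO_add_left additive_sum[of "\<lambda>f. scO f (wedge_list gs)", OF scO_add_left]
      by (intro arg_cong2[of _ _ _ _ "(+)"] sum.cong refl) simp
  qed
  also have "\<dots> = (\<Sum>gs\<in>L. scO (d (cochain_coeff \<gamma> gs)) (wedge_list gs)) +
      (\<Sum>j<k. \<Sum>gs\<in>L. scO (cochain_coeff \<gamma> gs) (wedge_list (?up gs j)))"
    unfolding sum.distrib by (subst sum.swap) (simp add: shift)
  also have "(\<Sum>j<k. \<Sum>gs\<in>L. scO (cochain_coeff \<gamma> gs) (wedge_list (?up gs j))) = (\<Sum>gs\<in>L. scO (cochain_coeff \<gamma> gs) (shift_sum gs))"
    by (subst sum.swap) (auto simp: shift_sum_def scO_sum L_def intro!: sum.cong)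
  also have "(\<Sum>gs\<in>L. scO (d (cochain_coeff \<gamma> gs)) (wedge_list gs)) + (\<Sum>gs\<in>L. scO (cochain_coeff \<gamma> gs) (shift_sum gs)) =
      dO d (\<Sum>gs\<in>L. scO (cochain_coeff \<gamma> gs) (wedge_list gs))"
    by (simp add: additive_sum[of "dO d", OF dO_add[OF d_add]] dO_wedge_list sum.distrib)
  also have "scO (emb (1 / fact k)) \<dots> = dO d (scO (emb (1 / fact k)) (\<Sum>gs\<in>L. scO (cochain_coeff \<gamma> gs) (wedge_list gs)))"
    by (simp only: dO_scO_emb)
  also have "scO (emb (1 / fact k)) (\<Sum>gs\<in>L. scO (cochain_coeff \<gamma> gs) (wedge_list gs)) = Phi emb k \<gamma>"
    unfolding L_def
  proof (rule Phi_eq_lists[OF fin, symmetric])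
    fix gs assume "length gs = k" "cochain_coeff \<gamma> gs \<noteq> 0"
    then have "gs \<in> L" using suppi[of gs] by (auto simp: L_iff less_imp_le)
    then show "set gs \<subseteq> ?G" by (simp add: L_def)
  qed
  finally show ?thesis .
qed

end

subsection \<open>Cochains are determined by their coefficients\<close>

lemma Gamma_tI:
  fixes \<gamma> :: "('i, 'f::field_char_0, 'v::comm_ring_1) cochain"
  assumes "\<And>as. length as \<noteq> k \<Longrightarrow> \<gamma> as = 0"
    and "\<And>as. length as = k \<Longrightarrow> vars_below k (\<gamma> as)"
    and "\<And>as j b c. length as = k \<Longrightarrow> j < k \<Longrightarrow>
      \<gamma> (as[j := (\<lambda>i. b i + c i)]) = \<gamma> (as[j := b]) + \<gamma> (as[j := c])"
    and "\<And>as j s b. length as = k \<Longrightarrow> j < k \<Longrightarrow> \<gamma> (as[j := smultA s b]) = lconst (emb s) * \<gamma> (as[j := b])"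
    and "\<And>as j. length as = k \<Longrightarrow> j < k \<Longrightarrow> \<gamma> (as[j := dA (as ! j)]) = - (lvar j * \<gamma> as)"
    and "\<And>as p. length as = k \<Longrightarrow> p permutes {..<k} \<Longrightarrow>
      ren p (\<gamma> (permute_list p as)) = lconst (of_int (sign p)) * \<gamma> as"
  shows "\<gamma> \<in> Gamma_t emb k"
  unfolding Gamma_t_def mem_Collect_eq
proof (intro conjI allI impI)
  fix as :: "('i, 'f) amod list" and \<sigma> assume "length as = k" "\<sigma> permutes {..<k}"
  then show "ren \<sigma> (\<gamma> (map (\<lambda>j. as ! \<sigma> j) [0..<k])) = lconst (of_int (sign \<sigma>)) * \<gamma> as"
    using assms(6)[of as \<sigma>] by (simp only: permute_list_def)
qed (fact assms(1-5))+

text \<open>A is generated by the u_i as a module over F[\<partial>]. Horner's scheme p = s +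
  \<partial> q builds each coefficient polynomial from the listed operations, and the zero element
  arises as 0 times a generator.\<close>

lemma amod_induct [case_names gen add smult dA]:
  fixes a :: "('i::finite, 'f::field_char_0) amod"
  assumes gen: "\<And>i. P (gen_u i)"
    and add: "\<And>a b. P a \<Longrightarrow> P b \<Longrightarrow> P (\<lambda>i. a i + b i)"
    and smult: "\<And>s a. P a \<Longrightarrow> P (smultA s a)"
    and dA: "\<And>a. P a \<Longrightarrow> P (dA a)"
  shows "P a"
proof -
  have "smultA 0 (gen_u undefined :: ('i, 'f) amod) = (\<lambda>_. 0)" by (simp add: smultA_def)
  then have zero: "P (\<lambda>_. 0)" using smult[OF gen] by metis
  have single: "P (\<lambda>c. if c = i then p else 0)" for i p
  proof (induction p)
    case 0
    then show ?case using zero by simp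
  next
    case (pCons s p)
    have eq: "(\<lambda>c. if c = i then pCons s p else 0) =
        (\<lambda>c. smultA s (gen_u i) c + dA (\<lambda>c. if c = i then p else 0) c)"
      by (auto simp: smultA_def gen_u_def dA_def one_pCons)
    show ?case unfolding eq by (rule add[OF smult[OF gen] dA[OF pCons(2)]])
  qed
  have "P (\<lambda>c. if c \<in> F then a c else 0)" if "finite F" for F
    using that
  proof (induction F rule: finite_induct)
    case (insert i F)
    have eq: "(\<lambda>c. if c \<in> insert i F then a c else 0) =
        (\<lambda>c. (if c = i then a i else 0) + (if c \<in> F then a c else 0))"
      using insert by auto
    show ?case unfolding eq by (rule add[OF single[of i "a i"] insert.IH])
  qed (simp add: zero)
  from this[of UNIV] show ?thesis by simp
qed

lemma Gamma_t_eqI: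
  fixes \<gamma> \<gamma>' :: "('i::finite, 'f::field_char_0, 'v::comm_ring_1) cochain"
  assumes \<gamma>: "\<gamma> \<in> Gamma_t emb k" and \<gamma>': "\<gamma>' \<in> Gamma_t emb k"
    and eq: "\<And>is. length is = k \<Longrightarrow> \<gamma> (map gen_u is) = \<gamma>' (map gen_u is)"
  shows "\<gamma> = \<gamma>'"
proof -
  \<comment> \<open>Slots from \<open>m\<close> on hold generators. Passing from \<open>m\<close> to
    m + 1 releases slot \<open>m\<close>, where the cochain axioms propagate equality from
    generators to all of A.\<close>
  have claim: "\<gamma> as = \<gamma>' as"
    if "length as = k" "\<And>j. m \<le> j \<Longrightarrow> j < k \<Longrightarrow> as ! j \<in> range gen_u" for m as
    using that
  proof (induction m arbitrary: as)
    case 0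
    then have "\<exists>is. as = map gen_u is"
      unfolding ex_map_conv by (metis in_set_conv_nth rangeE zero_le)
    then show ?case using eq 0(1) by auto
  next
    case (Suc m)
    show ?case
    proof (cases "m < k")
      case True
      have "\<gamma> (as[m := b]) = \<gamma>' (as[m := b])" for b
      proof (induction b rule: amod_induct)
        case (gen i)
        show ?case
          by (rule Suc.IH) (use Suc.prems True in \<open>auto simp: nth_list_update\<close>)
      next
        case (add a b)
        then show ?case using Gamma_t_add[OF \<gamma> Suc.prems(1) True] Gamma_t_add[OF \<gamma>' Suc.prems(1) True] by simp
      next
        case (smult s a)
        then show ?case using Gamma_t_smult[OF \<gamma> Suc.prems(1) True] Gamma_t_smult[OF \<gamma>' Suc.prems(1) True] by simp
      next
        case (dA b)
        have len: "length (as[m := b]) = k" using Suc.prems by simp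
        show ?case
          using Gamma_t_dA[OF \<gamma> len True] Gamma_t_dA[OF \<gamma>' len True] dA Suc.prems(1) True by simp
      qed
      from this[of "as ! m"] show ?thesis by simp
    next
      case False
      then show ?thesis using Suc by (metis Suc_leI le_SucE linorder_not_less order_trans nat_le_linear)
    qed
  qed
  show ?thesis
  proof
    fix as
    show "\<gamma> as = \<gamma>' as"
    proof (cases "length as = k")
      case True
      then show ?thesis by (rule claim[where m = k]) auto
    next
      case False
      then show ?thesis using Gamma_t_length[OF \<gamma>] Gamma_t_length[OF \<gamma>'] by simp
    qed
  qed
qed

lemma Gamma_t_eqI_cochain_coeff:
  fixes \<gamma> \<gamma>' :: "('i::finite, 'f::field_char_0, 'v::comm_ring_1) cochain"
  assumes \<gamma>: "\<gamma> \<in> Gamma_t emb k" and \<gamma>': "\<gamma>' \<in> Gamma_t emb k"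
    and eq: "\<And>gs. length gs = k \<Longrightarrow> cochain_coeff \<gamma> gs = cochain_coeff \<gamma>' gs"
  shows "\<gamma> = \<gamma>'"
proof (rule Gamma_t_eqI[OF \<gamma> \<gamma>'])
  fix "is" :: "'i list" assume len: "length is = k"
  show "\<gamma> (map gen_u is) = \<gamma>' (map gen_u is)"
  proof (rule poly_mapping_eqI)
    fix \<mu>
    show "lookup (\<gamma> (map gen_u is)) \<mu> = lookup (\<gamma>' (map gen_u is)) \<mu>"
    proof (cases "keys \<mu> \<subseteq> {..<k}")
      case True
      let ?ms = "map (lookup \<mu>) [0..<k]"
      have "map (\<lambda>g. gen_u (fst g)) (zip is ?ms) = (map gen_u is :: ('i, 'f) amod list)"
        using len by (intro nth_equalityI) auto
      moreover have "map snd (zip is ?ms) = ?ms" using len by simp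
      ultimately show ?thesis
        using eq[of "zip is ?ms"] len by (simp only: cochain_coeff_def mon_of_list_lookup[OF True]) simp
    next
      \<comment> \<open>Monomials in other variables occur in neither value, so the coefficients at
        lists of length \<open>k\<close> see everything.\<close>
      case False
      then have "\<mu> \<notin> keys (\<gamma> (map gen_u is))" "\<mu> \<notin> keys (\<gamma>' (map gen_u is))"
        using vars_below_Gamma_t[OF \<gamma>, of "map gen_u is"] vars_below_Gamma_t[OF \<gamma>', of "map gen_u is"]
        unfolding vars_below_def by blast+
      then show ?thesis by (simp add: in_keys_iff)
    qed
  qed
qed

lemma (in scalars) inj_on_Phi:
  "inj_on (Phi emb k :: ('i::{finite, linorder}, 'f, 'v) cochain \<Rightarrow> ('i, 'v) form) (Gamma_t emb k)"
proof (rule inj_onI)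
  fix \<gamma> \<gamma>' :: "('i, 'f, 'v) cochain"
  assume \<gamma>: "\<gamma> \<in> Gamma_t emb k" and \<gamma>': "\<gamma>' \<in> Gamma_t emb k" and eq: "Phi emb k \<gamma> = Phi emb k \<gamma>'"
  show "\<gamma> = \<gamma>'"
    by (rule Gamma_t_eqI_cochain_coeff[OF \<gamma> \<gamma>']) (simp add: cochain_coeff_eq_lookup_Phi[OF \<gamma>] cochain_coeff_eq_lookup_Phi[OF \<gamma>'] eq)
qed

subsection \<open>The cochain of a form\<close>

context scalars
begin

lemma emb_minus: "emb (- a) = - emb a"
  using emb_add[of "- a" a] by (simp add: emb_zero eq_neg_iff_add_eq_0)

lemma poly_neg_var_bound:
  assumes "degree p \<le> N"
  shows "poly_neg_var emb p j = (\<Sum>e\<le>N. single (single j e) (emb ((-1) ^ e * coeff p e)))"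
  unfolding poly_neg_var_def
  by (rule sum.mono_neutral_left) (use assms in \<open>auto simp: coeff_eq_0 emb_zero\<close>)

lemma poly_neg_var_add: "poly_neg_var emb (p + q) j = poly_neg_var emb p j + poly_neg_var emb q j"
proof -
  let ?N = "max (degree p) (degree q)"
  have "degree (p + q) \<le> ?N" by (rule degree_add_le) auto
  then show ?thesis
    by (simp add: poly_neg_var_bound[of p ?N] poly_neg_var_bound[of q ?N] poly_neg_var_bound[of "p + q" ?N]
        sum.distrib[symmetric] single_add[symmetric] emb_add[symmetric] distrib_left)
qed

lemma poly_neg_var_smult: "poly_neg_var emb (smult s p) j = lconst (emb s) * poly_neg_var emb p j"
  by (subst poly_neg_var_bound[OF degree_smult_le])
    (simp add: poly_neg_var_def sum_distrib_left lconst_def mult_single emb_mult[symmetric] ac_simps)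

text \<open>\<open>poly_neg_var\<close> is the substitution p(-\<lambda>_j), so multiplication by
  \<partial> produces the factor -\<lambda>_j of sesquilinearity.\<close>

lemma poly_neg_var_shift: "poly_neg_var emb ([:0, 1:] * p) j = - (lvar j * poly_neg_var emb p j)"
proof -
  have "poly_neg_var emb ([:0, 1:] * p) j =
      (\<Sum>e\<le>Suc (degree p). single (single j e) (emb ((-1) ^ e * coeff (pCons 0 p) e)))"
    using poly_neg_var_bound[of "pCons 0 p" "Suc (degree p)" j] by (simp add: degree_pCons_le)
  also have "\<dots> = (\<Sum>e\<le>degree p. single (single j (Suc e)) (emb ((-1) ^ Suc e * coeff p e)))"
    by (subst sum.atMost_Suc_shift) (simp add: emb_zero)
  also have "\<dots> = (\<Sum>e\<le>degree p. - (lvar j * single (single j e) (emb ((-1) ^ e * coeff p e))))"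
    by (rule sum.cong[OF refl])
      (simp add: lvar_def mult_single single_uminus[symmetric] emb_minus[symmetric] flip: single_add)
  finally show ?thesis by (simp add: poly_neg_var_def sum_negf sum_distrib_left)
qed

lemma ren_poly_neg_var: "ren \<rho> (poly_neg_var emb p j) = poly_neg_var emb p (\<rho> j)"
  by (simp add: poly_neg_var_def ren_sum ren_single ren_mon_single)

lemma vars_below_poly_neg_var: "j < k \<Longrightarrow> vars_below k (poly_neg_var emb p j)"
  unfolding poly_neg_var_def by (intro vars_below_sum vars_below_single) auto

text \<open>The sesquilinear extension of the coefficients read off from \<open>\<omega>\<close>:
  argument j enters through its coefficient polynomial at the index in slot j, evaluated at
  -\<lambda>_j. Restricting the lists to the support of \<open>\<omega>\<close> drops only zero
  terms and makes the sum finite for \<open>\<omega>\<close> in \<open>Omega_t k\<close>.\<close>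

definition cochain_of :: "nat \<Rightarrow> ('i::linorder, 'v) form \<Rightarrow> ('i, 'f, 'v) cochain" where
  "cochain_of k \<omega> as = (if length as = k then
     \<Sum>gs | set gs \<subseteq> \<Union>(keys \<omega>) \<and> length gs = k.
       (\<Prod>j<k. poly_neg_var emb ((as ! j) (fst (gs ! j))) j) *
       single (mon_of_list (map snd gs)) (of_int (list_sign gs) * lookup \<omega> (set gs))
     else 0)"

text \<open>The factors \<open>R\<close> do not involve \<open>b\<close>, so all axioms about slot
  \<open>j\<close> reduce to properties of \<open>poly_neg_var\<close>.\<close>

lemma cochain_of_update:
  assumes "length as = k" "j < k"
  obtains R where "\<And>b. cochain_of k \<omega> (as[j := b]) =
    (\<Sum>gs | set gs \<subseteq> \<Union>(keys \<omega>) \<and> length gs = k. poly_neg_var emb (b (fst (gs ! j))) j * R gs)"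
proof
  fix b
  have pr: "(\<Prod>i<k. poly_neg_var emb ((as[j := b] ! i) (fst (gs ! i))) i) =
      poly_neg_var emb (b (fst (gs ! j))) j * (\<Prod>i\<in>{..<k} - {j}. poly_neg_var emb ((as ! i) (fst (gs ! i))) i)" for gs
    using assms by (subst prod.remove[of _ j]) (auto intro!: arg_cong2[of _ _ _ _ "(*)"] prod.cong)
  show "cochain_of k \<omega> (as[j := b]) =
    (\<Sum>gs | set gs \<subseteq> \<Union>(keys \<omega>) \<and> length gs = k. poly_neg_var emb (b (fst (gs ! j))) j *
      ((\<Prod>i\<in>{..<k} - {j}. poly_neg_var emb ((as ! i) (fst (gs ! i))) i) *
        single (mon_of_list (map snd gs)) (of_int (list_sign gs) * lookup \<omega> (set gs))))"
    unfolding cochain_of_def length_list_update assms(1) if_P[OF refl] pr mult.assoc ..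
qed

lemma cochain_of_permute:
  assumes len: "length as = k" and p: "p permutes {..<k}"
  shows "ren p (cochain_of k \<omega> (permute_list p as)) = lconst (of_int (sign p)) * cochain_of k \<omega> as"
proof -
  let ?L = "{gs. set gs \<subseteq> \<Union>(keys \<omega>) \<and> length gs = k}"
  let ?F = "\<lambda>gs. (\<Prod>j<k. poly_neg_var emb ((as ! p j) (fst (gs ! j))) (p j)) *
    single (ren_mon p (mon_of_list (map snd gs))) (of_int (list_sign gs) * lookup \<omega> (set gs))"
  let ?H = "\<lambda>gs. (\<Prod>j<k. poly_neg_var emb ((as ! j) (fst (gs ! j))) j) *
    single (mon_of_list (map snd gs)) (of_int (list_sign gs) * lookup \<omega> (set gs))"
  have "ren p (cochain_of k \<omega> (permute_list p as)) = (\<Sum>gs\<in>?L. ?F gs)"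
    using len p by (simp add: cochain_of_def ren_sum ren_mult ren_prod ren_single ren_poly_neg_var permute_list_nth)
  also have "\<dots> = (\<Sum>gs\<in>?L. ?F (permute_list p gs))"
    by (rule sum.reindex_bij_betw[OF bij_permute_list_lists[OF p], symmetric])
  also have "\<dots> = (\<Sum>gs\<in>?L. lconst (of_int (sign p)) * ?H gs)"
  proof (rule sum.cong[OF refl])
    fix gs assume "gs \<in> ?L"
    then have gs: "length gs = k" "p permutes {..<length gs}" using p by auto
    have "(\<Prod>j<k. poly_neg_var emb ((as ! p j) (fst (permute_list p gs ! j))) (p j)) =
        (\<Prod>j<k. poly_neg_var emb ((as ! p j) (fst (gs ! p j))) (p j))"
      using gs by (intro prod.cong) (auto simp: permute_list_nth)
    also have "\<dots> = (\<Prod>j<k. poly_neg_var emb ((as ! j) (fst (gs ! j))) j)"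
      by (rule prod.reindex_bij_betw[OF permutes_imp_bij[OF p]])
    finally have 1: "(\<Prod>j<k. poly_neg_var emb ((as ! p j) (fst (permute_list p gs ! j))) (p j)) = \<dots>" .
    \<comment> \<open>The splitting of monomials, with an empty second block.\<close>
    have "mon_of_list (map snd gs) = ren_mon p (mon_of_list (map (\<lambda>j. map snd gs ! p j) [0..<k]))"
      using mon_of_list_split[of p k 0 "map snd gs"] p gs by (simp add: mon_of_list_def[of "[]"])
    moreover have "map (\<lambda>j. map snd gs ! p j) [0..<k] = map snd (permute_list p gs)"
      using map_take_permute_list(1)[of p k 0 gs snd] gs by simp
    ultimately have 2: "ren_mon p (mon_of_list (map snd (permute_list p gs))) = mon_of_list (map snd gs)" by simp
    have 3: "single \<mu> (of_int (y * z) * v) = lconst (of_int y) * single \<mu> (of_int z * (v :: 'v))" for \<mu> y z v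
      by (simp only: lconst_def mult_single of_int_mult mult.assoc add_0)
    show "?F (permute_list p gs) = lconst (of_int (sign p)) * ?H gs"
      unfolding 1 2 3 list_sign_permute[OF gs(2)] set_permute_list[OF gs(2)] by (rule mult.left_commute)
  qed
  also have "\<dots> = lconst (of_int (sign p)) * cochain_of k \<omega> as"
    using len by (simp add: cochain_of_def sum_distrib_left)
  finally show ?thesis .
qed

lemma cochain_of_in_Gamma_t:
  fixes \<omega> :: "('i::linorder, 'v) form"
  shows "cochain_of k \<omega> \<in> Gamma_t emb k"
proof (rule Gamma_tI)
  fix as :: "('i, 'f) amod list" and j b c s
  assume len: "length as = k" and j: "j < k"
  obtain R where R: "\<And>b. cochain_of k \<omega> (as[j := b]) =
    (\<Sum>gs | set gs \<subseteq> \<Union>(keys \<omega>) \<and> length gs = k. poly_neg_var emb (b (fst (gs ! j))) j * R gs)"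
    using cochain_of_update[OF len j] by blast
  show "cochain_of k \<omega> (as[j := \<lambda>i. b i + c i]) = cochain_of k \<omega> (as[j := b]) + cochain_of k \<omega> (as[j := c])"
    by (simp only: R poly_neg_var_add distrib_right sum.distrib)
  show "cochain_of k \<omega> (as[j := smultA s b]) = lconst (emb s) * cochain_of k \<omega> (as[j := b])"
    by (simp only: R smultA_def poly_neg_var_smult sum_distrib_left mult.assoc)
  have "cochain_of k \<omega> (as[j := dA (as ! j)]) = - (lvar j * cochain_of k \<omega> (as[j := as ! j]))"
    by (simp only: R dA_def poly_neg_var_shift sum_distrib_left mult.assoc sum_negf mult_minus_left)
  then show "cochain_of k \<omega> (as[j := dA (as ! j)]) = - (lvar j * cochain_of k \<omega> as)" by simp
next
  fix as :: "('i, 'f) amod list" assume "length as = k"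
  have "vars_below k ((\<Prod>j<k. poly_neg_var emb ((as ! j) (fst (gs ! j))) j) * single (mon_of_list (map snd gs)) v)"
    if "length gs = k" for gs v
    using that keys_mon_of_list[of "map snd gs"]
    by (intro vars_below_mult vars_below_prod vars_below_poly_neg_var vars_below_single) auto
  then show "vars_below k (cochain_of k \<omega> as)"
    unfolding cochain_of_def by (auto intro!: vars_below_sum)
qed (erule (1) cochain_of_permute | simp add: cochain_of_def)+

text \<open>On generators the product of substitutions is a Kronecker symbol in the indices, and the
  monomial is one in the orders, so only \<open>hs = gs\<close> survives.\<close>

lemma cochain_coeff_cochain_of:
  assumes fin: "finite (\<Union>(keys \<omega>))" and len: "length gs = k"
  shows "cochain_coeff (cochain_of k \<omega>) gs = of_int (list_sign gs) * lookup \<omega> (set gs)"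
proof -
  let ?L = "{gs. set gs \<subseteq> \<Union>(keys \<omega>) \<and> length gs = k}"
  let ?f = "\<lambda>gs. of_int (list_sign gs) * lookup \<omega> (set gs)"
  let ?as = "map (\<lambda>g. gen_u (fst g)) gs :: ('a, 'f) amod list"
  have "lookup ((\<Prod>j<k. poly_neg_var emb ((?as ! j) (fst (hs ! j))) j) *
      single (mon_of_list (map snd hs)) (?f hs)) (mon_of_list (map snd gs)) = (if hs = gs then ?f gs else 0)"
    if hs: "length hs = k" for hs
  proof -
    have pr: "(\<Prod>j<k. poly_neg_var emb ((?as ! j) (fst (hs ! j))) j) = (\<Prod>j<k. if fst (hs ! j) = fst (gs ! j) then 1 else 0)"
      using len by (intro prod.cong) (simp_all add: poly_neg_var_gen_u)
    show ?thesis
    proof (cases "\<forall>j<k. fst (hs ! j) = fst (gs ! j)")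
      case True
      then have "map fst hs = map fst gs" using hs len by (intro nth_equalityI) auto
      then have "map snd hs = map snd gs \<longleftrightarrow> hs = gs" by (metis zip_map_fst_snd)
      then show ?thesis using True hs len unfolding pr by (simp add: lookup_single when_def mon_of_list_eq_iff)
    next
      case False
      then have "hs \<noteq> gs" by auto
      moreover have "(\<Prod>j<k. if fst (hs ! j) = fst (gs ! j) then 1 else 0) = (0 :: 'v lpoly)"
        using False by (intro prod_zero) auto
      ultimately show ?thesis unfolding pr by simp
    qed
  qed
  then have "cochain_coeff (cochain_of k \<omega>) gs = (\<Sum>hs\<in>?L. if hs = gs then ?f gs else 0)"
    using len by (simp add: cochain_coeff_def cochain_of_def lookup_sum)
  also have "\<dots> = (if gs \<in> ?L then ?f gs else 0)"
    using finite_lists_in[OF fin] by simp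
  \<comment> \<open>If \<open>gs\<close> lies outside the range of summation, then
    \<open>set gs\<close> is not in the support and \<open>?f gs\<close> is 0 as well.\<close>
  also have "\<dots> = ?f gs"
  proof -
    have "gs \<in> ?L" if "set gs \<in> keys \<omega>" using that len by blast
    then show ?thesis by (cases "lookup \<omega> (set gs) = 0") (simp_all add: in_keys_iff)
  qed
  finally show ?thesis .
qed

lemma Phi_cochain_of:
  fixes \<omega> :: "('i::{finite, linorder}, 'v) form"
  assumes "\<omega> \<in> Omega_t k"
  shows "Phi emb k (cochain_of k \<omega>) = \<omega>"
proof (rule Omega_t_eqI[OF Phi_in_Omega_t assms])
  have fin: "finite (\<Union>(keys \<omega>))" using Omega_t_keysD[OF assms] by auto
  fix S :: "('i \<times> nat) set" assume "finite S" "card S = k"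
  then show "lookup (Phi emb k (cochain_of k \<omega>)) S = lookup \<omega> S"
    by (rule lookup_Phi_alternating) (use \<open>card S = k\<close> in \<open>auto simp: cochain_coeff_cochain_of[OF fin] distinct_card\<close>)
qed

lemma bij_betw_Phi:
  "bij_betw (Phi emb k :: ('i::{finite, linorder}, 'f, 'v) cochain \<Rightarrow> ('i, 'v) form) (Gamma_t emb k) (Omega_t k)"
  unfolding bij_betw_def
proof (intro conjI inj_on_Phi equalityI subsetI)
  fix \<omega> :: "('i, 'v) form" assume "\<omega> \<in> Omega_t k"
  then show "\<omega> \<in> Phi emb k ` (Gamma_t emb k :: ('i, 'f, 'v) cochain set)"
    using Phi_cochain_of cochain_of_in_Gamma_t by (metis image_eqI)
qed (use Phi_in_Omega_t in auto)

end

subsection \<open>The reduced complexes\<close>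

text \<open>\<partial> is F-linear and commutes with renaming and with multiplication by the
  variables, and the sum of the \<lambda>_j is symmetric. Membership is what lets injectivity of
  \<open>Phi\<close> be applied when \<partial>-images of forms are lifted to cochains.\<close>

lemma (in diff_functions) dG_in_Gamma_t:
  fixes \<gamma> :: "('i, 'f, 'v) cochain"
  assumes \<gamma>: "\<gamma> \<in> Gamma_t emb k"
  shows "dG d k \<gamma> \<in> Gamma_t emb k"
proof (rule Gamma_tI)
  have d_minus: "d (- a) = - d a" for a
    using additive_of_int_mult[of d "-1" a, OF d_add] by simp
  have c_add: "coeffwise d (P + Q) = coeffwise d P + coeffwise d Q" for P Q
    by (rule coeffwise_add[OF d_add])
  have c_lconst: "coeffwise d (lconst (emb s) * Q) = lconst (emb s) * coeffwise d Q" for s Q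
    by (rule poly_mapping_eqI) (simp add: lookup_coeffwise lookup_lconst_mult d_zero d_emb)
  have c_int: "coeffwise d (lconst (of_int z) * Q) = lconst (of_int z) * coeffwise d Q" for z Q
    by (rule poly_mapping_eqI)
      (simp add: lookup_coeffwise lookup_lconst_mult d_zero additive_of_int_mult[of d, OF d_add])
  have c_lvar: "coeffwise d (- (lvar j * Q)) = - (lvar j * coeffwise d Q)" for j Q
    by (rule poly_mapping_eqI) (simp add: lookup_coeffwise lookup_lvar_mult d_zero d_minus)
  have c_ren: "ren \<rho> (coeffwise d Q) = coeffwise d (ren \<rho> Q)" for \<rho> Q
    by (induction Q rule: poly_mapping_additive_induct)
      (simp_all add: coeffwise_single d_zero ren_single ren_add c_add)
  fix as :: "('i, 'f) amod list"
  show "dG d k \<gamma> as = 0" if "length as \<noteq> k"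
    by (simp add: dG_def Gamma_t_length[OF \<gamma> that] coeffwise_def)
  assume len: "length as = k"
  show "vars_below k (dG d k \<gamma> as)"
    unfolding dG_def using vars_below_Gamma_t[OF \<gamma>, of as]
    by (intro vars_below_add vars_below_coeffwise vars_below_mult vars_below_sum vars_below_lvar) (auto simp: d_zero)
  show "dG d k \<gamma> (as[j := \<lambda>i. b i + c i]) = dG d k \<gamma> (as[j := b]) + dG d k \<gamma> (as[j := c])" if "j < k" for j b c
    unfolding dG_def Gamma_t_add[OF \<gamma> len that] c_add by (simp add: distrib_left)
  show "dG d k \<gamma> (as[j := smultA s b]) = lconst (emb s) * dG d k \<gamma> (as[j := b])" if "j < k" for j s b
    unfolding dG_def Gamma_t_smult[OF \<gamma> len that] c_lconst by (simp add: distrib_left mult.left_commute)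
  show "dG d k \<gamma> (as[j := dA (as ! j)]) = - (lvar j * dG d k \<gamma> as)" if "j < k" for j
    unfolding dG_def Gamma_t_dA[OF \<gamma> len that] c_lvar by (simp add: distrib_left mult.left_commute)
  show "ren p (dG d k \<gamma> (permute_list p as)) = lconst (of_int (sign p)) * dG d k \<gamma> as" if p: "p permutes {..<k}" for p
  proof -
    have "ren p (\<Sum>j<k. lvar j) = (\<Sum>j<k. lvar (p j))" by (simp add: ren_sum ren_lvar)
    also have "\<dots> = (\<Sum>j<k. lvar j)" by (rule sum.reindex_bij_betw[OF permutes_imp_bij[OF p]])
    finally have vars: "ren p (\<Sum>j<k. lvar j) = (\<Sum>j<k. lvar j :: 'v lpoly)" .
    show ?thesis
      unfolding dG_def ren_add ren_mult vars c_ren Gamma_t_permute[OF \<gamma> len p] c_int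
      by (simp add: distrib_left mult.left_commute)
  qed
qed

theorem theorem4p6:
  fixes emb :: "'f::field_char_0 \<Rightarrow> 'v::comm_ring_1"
    and d :: "'v \<Rightarrow> 'v"
    and pd :: "'i::{finite, linorder} \<Rightarrow> nat \<Rightarrow> 'v \<Rightarrow> 'v"
  assumes V: "alg_diff_fun emb d pd"
  shows
    \<comment> \<open>\<Phi>^0 is the identity of V\<close>
    "(\<forall>\<gamma>::('i, 'f, 'v) cochain\<in>Gamma_t emb 0. Phi emb 0 \<gamma> = Poly_Mapping.single {} (Poly_Mapping.lookup (\<gamma> []) 0))
     \<and> (\<forall>k. bij_betw (Phi emb k :: ('i, 'f, 'v) cochain \<Rightarrow> ('i, 'v) form) (Gamma_t emb k) (Omega_t k))
     \<and> (\<forall>k. \<forall>\<alpha>::('i, 'f, 'v) cochain\<in>Gamma_t emb k. \<forall>\<beta>::('i, 'f, 'v) cochain\<in>Gamma_t emb k.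
          Phi emb k (\<lambda>as. \<alpha> as + \<beta> as) = Phi emb k \<alpha> + Phi emb k \<beta>)
     \<and> (\<forall>h k. \<forall>\<alpha>::('i, 'f, 'v) cochain\<in>Gamma_t emb h. \<forall>\<beta>::('i, 'f, 'v) cochain\<in>Gamma_t emb k.
          Phi emb (h + k) (wedgeG emb h k \<alpha> \<beta>) = wedgeO (Phi emb h \<alpha>) (Phi emb k \<beta>))
     \<and> (\<forall>k. \<forall>\<gamma>::('i, 'f, 'v) cochain\<in>Gamma_t emb k.
          Phi emb (Suc k) (deltaG emb pd k \<gamma>) = deltaO pd (Phi emb k \<gamma>))
     \<and> (\<forall>(P :: 'i \<Rightarrow> nat \<Rightarrow> 'v) k. \<forall>\<gamma>::('i, 'f, 'v) cochain\<in>Gamma_t emb (Suc k).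
          Phi emb k (iotaG emb P \<gamma>) = iotaO P (Phi emb (Suc k) \<gamma>))
     \<and> (\<forall>k. \<forall>\<gamma>::('i, 'f, 'v) cochain\<in>Gamma_t emb k. Phi emb k (dG d k \<gamma>) = dO d (Phi emb k \<gamma>))
     \<and> (\<forall>k. \<forall>\<gamma>::('i, 'f, 'v) cochain\<in>Gamma_t emb k.
          (\<exists>\<beta>\<in>Gamma_t emb k. \<gamma> = dG d k \<beta>) \<longleftrightarrow> (\<exists>\<omega>\<in>Omega_t k. Phi emb k \<gamma> = dO d \<omega>))"
proof -
  interpret diff_functions emb d pd
    by unfold_locales (use V in \<open>auto simp: alg_diff_fun_def\<close>)
  \<comment> \<open>With additivity and bijectivity, this makes the induced map on the quotients by
    \<partial> well defined and injective.\<close>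
  have exact: "(\<exists>\<beta>\<in>Gamma_t emb k. \<gamma> = dG d k \<beta>) \<longleftrightarrow> (\<exists>\<omega>\<in>Omega_t k. Phi emb k \<gamma> = dO d \<omega>)"
    if \<gamma>: "\<gamma> \<in> Gamma_t emb k" for k and \<gamma> :: "('i, 'f, 'v) cochain"
  proof
    assume "\<exists>\<beta>\<in>Gamma_t emb k. \<gamma> = dG d k \<beta>"
    then show "\<exists>\<omega>\<in>Omega_t k. Phi emb k \<gamma> = dO d \<omega>" using Phi_dG Phi_in_Omega_t by blast
  next
    assume "\<exists>\<omega>\<in>Omega_t k. Phi emb k \<gamma> = dO d \<omega>"
    then obtain \<omega> where \<omega>: "\<omega> \<in> Omega_t k" "Phi emb k \<gamma> = dO d \<omega>" by blast
    \<comment> \<open>The explicit preimage of \<open>\<omega>\<close>: its \<partial> has the same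
      image as \<open>\<gamma>\<close>, and injectivity identifies the two.\<close>
    let ?\<beta> = "cochain_of k \<omega> :: ('i, 'f, 'v) cochain"
    have "Phi emb k \<gamma> = Phi emb k (dG d k ?\<beta>)" by (simp add: Phi_dG Phi_cochain_of \<omega>)
    then have "\<gamma> = dG d k ?\<beta>"
      by (rule inj_onD[OF inj_on_Phi _ \<gamma> dG_in_Gamma_t[OF cochain_of_in_Gamma_t]])
    then show "\<exists>\<beta>\<in>Gamma_t emb k. \<gamma> = dG d k \<beta>" using cochain_of_in_Gamma_t by blast
  qed
  show ?thesis
    by (intro conjI allI ballI bij_betw_Phi Phi_add Phi_wedgeG Phi_deltaG Phi_iotaG Phi_dG exact)
      (simp_all add: Phi_def)
qed

end
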